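(* If there exists a pseudorandom quantum states generator which, on input $k\in\{0,1\}^n$, outputs an $m$-qubit state with $m=m(n)\ge cn$ for some constant $c>1$, then a one-way quantum states generator exists.
   Context: Conventions. QPT means (uniform) quantum polynomial time. A function $f$ is negligible if for every constant $c>0$, $f(\lambda)<\lambda^{-c}$ for all large enough $\lambda$; $\mathsf{negl}$ denotes a negligible function. $k\leftarrow\{0,1\}^n$ means $k$ is sampled uniformly at random. Standing convention for both notions below: the output state is pure and no ancilla is left over, i.e. on input $k$ the algorithm computes in classical polynomial time a description of a unitary quantum circuit $U_k$ and outputs $|\phi_k\rangle=U_k|0\ldots0\rangle$. Pseudorandom quantum states generator (PRSG). A PRSG is a QPT algorithm $\mathsf{StateGen}$ that, on input $k\in\{0,1\}^n$, outputs an $m$-qubit quantum state $|\phi_k\rangle$, such that for every polynomial $t$ and every non-uniform QPT adversary $\mathcal{A}$ there is a negligible function $\mathsf{negl}$ such that for all $n$, $$\Big|\Pr_{k\leftarrow\{0,1\}^n}[\mathcal{A}(|\phi_k\rangle^{\otimes t(n)})\to1]-\Pr_{|\psi\rangle\leftarrow\mu_m}[\mathcal{A}(|\psi\rangle^{\otimes t(n)})\to1]\Big|\le\mathsf{negl}(n),$$ where $\mu_m$ is the Haar measure on $m$-qubit pure states. One-way quantum states generator (OWSG). Let $G$ be a QPT algorithm that, on input $k\in\{0,1\}^n$, outputs a quantum state $|\phi_k\rangle$. Consider the game $\mathsf{Exp}$ between a challenger $\mathcal{C}$ and an adversary $\mathcal{A}$: (1) $\mathcal{C}$ chooses $k\leftarrow\{0,1\}^n$.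 (2) $\mathcal{C}$ runs $|\phi_k\rangle\leftarrow G(k)$ $t+1$ times. (3) $\mathcal{C}$ sends $|\phi_k\rangle^{\otimes t}$ to $\mathcal{A}$. (4) $\mathcal{A}$ sends $\sigma\in\{0,1\}^n$ to $\mathcal{C}$. (5) $\mathcal{C}$ measures the remaining copy of $|\phi_k\rangle$ with $\{|\phi_\sigma\rangle\langle\phi_\sigma|,I-|\phi_\sigma\rangle\langle\phi_\sigma|\}$; the output is 1 if the result is $|\phi_\sigma\rangle\langle\phi_\sigma|$ and 0 otherwise. $G$ is a OWSG if for every $t=\mathrm{poly}(n)$ and every QPT $\mathcal{A}$ there is a negligible function with $\Pr[\mathsf{Exp}=1]\le\mathsf{negl}(n)$. *)

theory Defs
  imports "HOL-Probability.Probability" "HOL-Computational_Algebra.Polynomial"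
begin

section \<open>Classical polynomial time\<close>

datatype move = MoveLeft | Stay | MoveRight

text \<open>
  Deterministic single-tape Turing machines.  The states are the numbers below \<open>num_states\<close>, with
  0 the initial and 1 the halting state; the tape symbols are the numbers below \<open>num_syms\<close>, with
  0 the blank and 1, 2 the bits 0, 1.  The tape is infinite to the right; a left move in
  cell 0 leaves the head there.
\<close>

record turing_machine =
  num_states :: nat
  num_syms :: nat
  delta :: "nat \<Rightarrow> nat \<Rightarrow> nat \<times> nat \<times> move"

definition wf_tm :: "turing_machine \<Rightarrow> bool" where
  "wf_tm M \<longleftrightarrow> num_states M \<ge> 2 \<and> num_syms M \<ge> 3 \<and>
     (\<forall>q < num_states M. \<forall>a < num_syms M.
        case delta M q a of (q', b, d) \<Rightarrow> q' < num_states M \<and> b < num_syms M)"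

text \<open>A configuration consists of the state, the head position and the tape content.\<close>

type_synonym tm_config = "nat \<times> nat \<times> (nat \<Rightarrow> nat)"

fun move_head :: "move \<Rightarrow> nat \<Rightarrow> nat" where
  "move_head MoveLeft h = h - 1"
| "move_head Stay h = h"
| "move_head MoveRight h = h + 1"

fun tm_step :: "turing_machine \<Rightarrow> tm_config \<Rightarrow> tm_config" where
  "tm_step M (q, h, tape) =
     (if q = 1 then (q, h, tape)
      else case delta M q (tape h) of (q', b, d) \<Rightarrow> (q', move_head d h, tape(h := b)))"

definition sym_of_bit :: "bool \<Rightarrow> nat" where
  "sym_of_bit b = (if b then 2 else 1)"

definition tm_init :: "bool list \<Rightarrow> tm_config" where
  "tm_init w = (0, 0, \<lambda>i. if i < length w then sym_of_bit (w ! i) else 0)"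

text \<open>The output of a halted machine is the bit string up to the first blank cell.\<close>

definition tm_halted_with :: "tm_config \<Rightarrow> bool list \<Rightarrow> bool" where
  "tm_halted_with cfg v \<longleftrightarrow>
     (case cfg of (q, h, tape) \<Rightarrow>
        q = 1 \<and> (\<forall>i < length v. tape i = sym_of_bit (v ! i)) \<and> tape (length v) = 0)"

text \<open>
  Halted configurations are fixed points of \<^const>\<open>tm_step\<close>, so the following says that the
  machine halts within \<open>p(|w|)\<close> steps.
\<close>

definition polytime_computable :: "(bool list \<Rightarrow> bool list) \<Rightarrow> bool" where
  "polytime_computable f \<longleftrightarrow>
     (\<exists>M (p :: nat poly). wf_tm M \<and>
        (\<forall>w. tm_halted_with ((tm_step M ^^ poly p (length w)) (tm_init w)) (f w)))"


section \<open>Quantum circuits\<close>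

text \<open>
  Amplitude vectors are indexed by natural numbers: in the computational basis state \<open>x\<close>, qubit
  \<open>i\<close> has the value \<open>bit x i\<close>.  An \<open>m\<close>-qubit state is supported on \<open>{..<2 ^ m}\<close>.  It may also be
  read as a state of any larger number of qubits, the additional ones being in state 0.
\<close>

type_synonym qvec = "nat \<Rightarrow> complex"

definition pure_states :: "nat \<Rightarrow> qvec set" where
  "pure_states m = {\<psi>. (\<forall>x \<ge> 2 ^ m. \<psi> x = 0) \<and> (\<Sum>x<2 ^ m. (cmod (\<psi> x))\<^sup>2) = 1}"

definition ket0 :: qvec where
  "ket0 x = (if x = 0 then 1 else 0)"

definition overlap :: "nat \<Rightarrow> qvec \<Rightarrow> qvec \<Rightarrow> real" where
  "overlap m \<phi> \<psi> = (cmod (\<Sum>x<2 ^ m. cnj (\<phi> x) * \<psi> x))\<^sup>2"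

text \<open>\<open>\<psi>\<close> on qubits \<open>0, \<dots>, m - 1\<close>, tensored with \<open>\<phi>\<close> on the qubits from \<open>m\<close> onwards.\<close>

definition tensor :: "nat \<Rightarrow> qvec \<Rightarrow> qvec \<Rightarrow> qvec" where
  "tensor m \<psi> \<phi> x = \<psi> (take_bit m x) * \<phi> (drop_bit m x)"

text \<open>\<open>t\<close> copies of the \<open>m\<close>-qubit state \<open>\<psi>\<close> (followed by qubits in state 0).\<close>

definition copies :: "nat \<Rightarrow> nat \<Rightarrow> qvec \<Rightarrow> qvec" where
  "copies m t \<psi> = (tensor m \<psi> ^^ t) ket0"

text \<open>Circuits over the universal gate set Clifford+T, with the Toffoli gate as a primitive.\<close>

datatype gate =
    Hadamard nat
  | TGate nat
  | CNOT nat nat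
  | Toffoli nat nat nat

fun gate_qubits :: "gate \<Rightarrow> nat list" where
  "gate_qubits (Hadamard i) = [i]"
| "gate_qubits (TGate i) = [i]"
| "gate_qubits (CNOT a i) = [a, i]"
| "gate_qubits (Toffoli a b i) = [a, b, i]"

fun apply_gate :: "gate \<Rightarrow> qvec \<Rightarrow> qvec" where
  "apply_gate (Hadamard i) \<psi> =
     (\<lambda>x. (\<psi> (unset_bit i x) + (if bit x i then - 1 else 1) * \<psi> (set_bit i x)) / sqrt 2)"
| "apply_gate (TGate i) \<psi> = (\<lambda>x. (if bit x i then cis (pi / 4) else 1) * \<psi> x)"
| "apply_gate (CNOT a i) \<psi> = (\<lambda>x. \<psi> (if bit x a then flip_bit i x else x))"
| "apply_gate (Toffoli a b i) \<psi> = (\<lambda>x. \<psi> (if bit x a \<and> bit x b then flip_bit i x else x))"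

record circuit =
  width :: nat
  gates :: "gate list"

definition valid_circuit :: "circuit \<Rightarrow> bool" where
  "valid_circuit C \<longleftrightarrow>
     (\<forall>g \<in> set (gates C). distinct (gate_qubits g) \<and> (\<forall>i \<in> set (gate_qubits g). i < width C))"

definition run_circuit :: "circuit \<Rightarrow> qvec \<Rightarrow> qvec" where
  "run_circuit C \<psi> = fold apply_gate (gates C) \<psi>"

definition circuit_size :: "circuit \<Rightarrow> nat" where
  "circuit_size C = width C + length (gates C)"

text \<open>Bit string descriptions of circuits; numbers are written in unary.\<close>

definition encode_nat :: "nat \<Rightarrow> bool list" where
  "encode_nat i = replicate i True @ [False]"

fun gate_tag :: "gate \<Rightarrow> bool list" where
  "gate_tag (Hadamard _) = [False, False]"
| "gate_tag (TGate _) = [False, True]"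
| "gate_tag (CNOT _ _) = [True, False]"
| "gate_tag (Toffoli _ _ _) = [True, True]"

definition encode_gate :: "gate \<Rightarrow> bool list" where
  "encode_gate g = gate_tag g @ concat (map encode_nat (gate_qubits g))"

definition encode_circuit :: "circuit \<Rightarrow> bool list" where
  "encode_circuit C = encode_nat (width C) @ concat (map encode_gate (gates C))"

lemma encode_nat_append_inject:
  "encode_nat i @ u = encode_nat j @ v \<longleftrightarrow> i = j \<and> u = v"
proof (induction i arbitrary: j)
  case 0
  then show ?case by (cases j) (auto simp: encode_nat_def)
next
  case (Suc i)
  then show ?case by (cases j) (auto simp: encode_nat_def)
qed

lemma encode_gate_append_inject:
  "encode_gate g @ u = encode_gate h @ v \<longleftrightarrow> g = h \<and> u = v"
  by (cases g; cases h) (auto simp: encode_gate_def encode_nat_append_inject)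

lemma encode_gates_inject:
  "concat (map encode_gate gs) = concat (map encode_gate hs) \<longleftrightarrow> gs = hs"
proof (induction gs arbitrary: hs)
  case Nil
  have "encode_gate h \<noteq> []" for h by (cases h) (auto simp: encode_gate_def)
  then show ?case by (cases hs) auto
next
  case (Cons g gs)
  have "encode_gate g \<noteq> []" by (cases g) (auto simp: encode_gate_def)
  with Cons show ?case by (cases hs) (auto simp: encode_gate_append_inject)
qed

lemma inj_encode_circuit: "inj encode_circuit"
  by (rule injI)
     (simp add: encode_circuit_def encode_nat_append_inject encode_gates_inject)

text \<open>
  Probability that a computational basis measurement of all qubits after running \<open>C\<close> on \<open>\<psi>\<close>
  gives a result in \<open>S\<close>.
\<close>

definition outcome_prob :: "circuit \<Rightarrow> qvec \<Rightarrow> nat set \<Rightarrow> real" where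
  "outcome_prob C \<psi> S = (\<Sum>x \<in> S \<inter> {..<2 ^ width C}. (cmod (run_circuit C \<psi> x))\<^sup>2)"

text \<open>Adversaries return the measured value of qubit 0, respectively of the first qubits.\<close>

definition accept_prob :: "circuit \<Rightarrow> qvec \<Rightarrow> real" where
  "accept_prob C \<psi> = outcome_prob C \<psi> {x. bit x 0}"

definition output_prob :: "circuit \<Rightarrow> qvec \<Rightarrow> bool list \<Rightarrow> real" where
  "output_prob C \<psi> \<sigma> = outcome_prob C \<psi> {x. \<forall>i < length \<sigma>. bit x i = \<sigma> ! i}"

text \<open>
  A quantum algorithm is a family of circuits, one for each security parameter.  It is
  non-uniform QPT if the circuits have polynomial size, and (uniform) QPT if their
  descriptions can be computed in classical polynomial time from the security parameter in unary.
\<close>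

definition nonuniform_QPT :: "(nat \<Rightarrow> circuit) \<Rightarrow> bool" where
  "nonuniform_QPT A \<longleftrightarrow>
     (\<forall>n. valid_circuit (A n)) \<and> (\<exists>p :: nat poly. \<forall>n. circuit_size (A n) \<le> poly p n)"

definition uniform_QPT :: "(nat \<Rightarrow> circuit) \<Rightarrow> bool" where
  "uniform_QPT A \<longleftrightarrow>
     (\<forall>n. valid_circuit (A n)) \<and>
     (\<exists>f. polytime_computable f \<and> (\<forall>n. f (replicate n True) = encode_circuit (A n)))"


section \<open>Haar measure on pure states\<close>

definition unitary :: "nat \<Rightarrow> (nat \<Rightarrow> nat \<Rightarrow> complex) \<Rightarrow> bool" where
  "unitary d U \<longleftrightarrow>
     (\<forall>x<d. \<forall>y<d. (\<Sum>z<d. cnj (U z x) * U z y) = (if x = y then 1 else 0))"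

definition apply_matrix :: "nat \<Rightarrow> (nat \<Rightarrow> nat \<Rightarrow> complex) \<Rightarrow> qvec \<Rightarrow> qvec" where
  "apply_matrix d U \<psi> = (\<lambda>x. if x < d then (\<Sum>y<d. U x y * \<psi> y) else 0)"

text \<open>
  The unitarily invariant Borel probability measure on the unit sphere; it exists and is unique for
  each \<open>m\<close>.  States are unit vectors rather than rays, which makes no difference below since
  global phases do not affect measurement statistics.
\<close>

definition haar_states :: "nat \<Rightarrow> qvec measure \<Rightarrow> bool" where
  "haar_states m \<mu> \<longleftrightarrow>
     prob_space \<mu> \<and>
     sets \<mu> = sets (restrict_space borel (pure_states m)) \<and>
     (\<forall>U. unitary (2 ^ m) U \<longrightarrow> distr \<mu> \<mu> (apply_matrix (2 ^ m) U) = \<mu>)"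


section \<open>Quantum state generators\<close>

definition negligible :: "(nat \<Rightarrow> real) \<Rightarrow> bool" where
  "negligible f \<longleftrightarrow> (\<forall>c>0. \<forall>\<^sub>F n in sequentially. f n < real n powr (- c))"

definition uniform_keys :: "nat \<Rightarrow> bool list pmf" where
  "uniform_keys n = pmf_of_set {k. length k = n}"

text \<open>
  A generator is given by the function mapping a key \<open>k\<close> to the unitary circuit on \<open>m(|k|)\<close> qubits
  (hence without ancillas) that prepares the output state from the all-zero state.
\<close>

definition state_generator :: "(nat \<Rightarrow> nat) \<Rightarrow> (bool list \<Rightarrow> circuit) \<Rightarrow> bool" where
  "state_generator m G \<longleftrightarrow>
     polytime_computable (\<lambda>k. encode_circuit (G k)) \<and>
     (\<forall>k. valid_circuit (G k) \<and> width (G k) = m (length k))"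

definition gen_state :: "(bool list \<Rightarrow> circuit) \<Rightarrow> bool list \<Rightarrow> qvec" where
  "gen_state G k = run_circuit (G k) ket0"

text \<open>
  The condition \<open>t n * m n \<le> width (A n)\<close> says that the circuit takes the \<open>t(n)\<close> given copies as
  input; its remaining qubits are ancillas initialised to 0.
\<close>

definition PRSG :: "(nat \<Rightarrow> nat) \<Rightarrow> (bool list \<Rightarrow> circuit) \<Rightarrow> bool" where
  "PRSG m G \<longleftrightarrow>
     state_generator m G \<and>
     (\<exists>\<mu>. (\<forall>n. haar_states (m n) (\<mu> n)) \<and>
       (\<forall>(t :: nat poly) A.
          nonuniform_QPT A \<and> (\<forall>n. poly t n * m n \<le> width (A n) \<and> 1 \<le> width (A n)) \<longrightarrow>
          (\<exists>negl. negligible negl \<and>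
            (\<forall>n. \<bar>measure_pmf.expectation (uniform_keys n)
                     (\<lambda>k. accept_prob (A n) (copies (m n) (poly t n) (gen_state G k)))
                  - (LINT \<psi>|\<mu> n. accept_prob (A n) (copies (m n) (poly t n) \<psi>))\<bar> \<le> negl n))))"

text \<open>
  Probability that the game outputs 1: the adversary's circuit \<open>C\<close>, run on \<open>t\<close> copies, returns
  some \<open>\<sigma>\<close>, and the projective measurement of the remaining copy accepts.
\<close>

definition owsg_game ::
    "(nat \<Rightarrow> nat) \<Rightarrow> (bool list \<Rightarrow> circuit) \<Rightarrow> nat \<Rightarrow> circuit \<Rightarrow> nat \<Rightarrow> real" where
  "owsg_game m G t C n =
     measure_pmf.expectation (uniform_keys n)
       (\<lambda>k. \<Sum>\<sigma> | length \<sigma> = n.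
          output_prob C (copies (m n) t (gen_state G k)) \<sigma>
          * overlap (m n) (gen_state G \<sigma>) (gen_state G k))"

text \<open>Here \<open>t\<close> ranges over all polynomially bounded functions.\<close>

definition OWSG :: "(nat \<Rightarrow> nat) \<Rightarrow> (bool list \<Rightarrow> circuit) \<Rightarrow> bool" where
  "OWSG m G \<longleftrightarrow>
     state_generator m G \<and>
     (\<forall>t A. (\<exists>p :: nat poly. \<forall>n. t n \<le> poly p n) \<and>
        uniform_QPT A \<and> (\<forall>n. t n * m n \<le> width (A n) \<and> n \<le> width (A n)) \<longrightarrow>
        (\<exists>negl. negligible negl \<and> (\<forall>n. owsg_game m G (t n) (A n) n \<le> negl n)))"

end

theory Submission
  imports Defs "HOL-Real_Asymp.Real_Asymp"
begin

text \<open>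
  The pseudorandom generator is itself one-way.  An adversary \<open>A\<close> for the one-wayness game gives a
  distinguisher: run \<open>A\<close> on \<open>t\<close> copies to obtain \<open>\<sigma>\<close>, apply the inverse of the preparation circuit of
  \<open>\<phi>\<^sub>\<sigma>\<close> to a further copy and accept if the result is the all-zero state.  On \<open>\<phi>\<^sub>k\<close> it accepts with
  the success probability of \<open>A\<close>.  On a Haar random state the overlap with each fixed \<open>\<phi>\<^sub>\<sigma>\<close> is
  \<open>1 / 2^m\<close> on average, so that even the sum over all \<open>2^n\<close> strings \<open>\<sigma>\<close> is only \<open>2^(n - m)\<close>,
  which is negligible.

  Since \<open>\<sigma>\<close> is only known in superposition, the distinguisher contains the computation
  tableau of the machine that maps \<open>\<sigma>\<close> to the description of its circuit, as a circuit of
  Toffoli gates, followed by a parser of this description.  Its wires then control the inverse gates.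
\<close>

section \<open>Gates\<close>

text \<open>The classical computation runs on a superposition of strings and leaves garbage on its
  wires. This is harmless: it permutes basis states, each of which then carries its own gate list,
  and acceptance only adds squared amplitudes over these basis states. So the acceptance probability
  is an exact expression, valid for every pure state on the tested register, and one identity serves
  both for keys and for Haar random states. The gate set has neither NOT nor the inverse of T, so
  both have to be built from powers of T. The one-wayness game allows every polynomially bounded
  number of copies, whereas pseudorandomness speaks of a polynomial; the surplus copies are carried
  along untouched. The Haar average needs only second moments, which follow from invariance under
  sign changes and transpositions of coordinates. As pseudorandomness holds against nonuniform
  adversaries, the distinguisher only has to be small; no machine has to produce it.\<close>

lemma flip_bit_flip_bit [simp]: "flip_bit i (flip_bit i x) = (x :: nat)"
  by (rule bit_eqI) (auto simp: bit_flip_bit_iff)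

lemma bit_less_power: "x < 2 ^ w \<Longrightarrow> w \<le> i \<Longrightarrow> \<not> bit (x :: nat) i"
  by (metis bit_take_bit_iff leD take_bit_nat_eq_self)

lemma less_power_bitI:
  assumes "\<And>i. w \<le> i \<Longrightarrow> \<not> bit (x :: nat) i"
  shows "x < 2 ^ w"
proof -
  have "take_bit w x = x"
    by (rule bit_eqI) (metis assms bit_take_bit_iff not_less)
  then show ?thesis by (metis take_bit_nat_less_exp)
qed

lemma flip_bit_less: "i < w \<Longrightarrow> flip_bit i x < 2 ^ w \<longleftrightarrow> (x :: nat) < 2 ^ w"
proof -
  have *: "flip_bit i x < 2 ^ w" if "i < w" "x < 2 ^ w" for x :: nat
    by (rule less_power_bitI) (use that in \<open>auto simp: bit_flip_bit_iff bit_less_power\<close>)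
  show "i < w \<Longrightarrow> ?thesis" using *[of x] *[of "flip_bit i x"] by auto
qed

definition valid_gate :: "nat \<Rightarrow> gate \<Rightarrow> bool" where
  "valid_gate w g \<longleftrightarrow> distinct (gate_qubits g) \<and> (\<forall>i \<in> set (gate_qubits g). i < w)"

lemma valid_circuit_iff: "valid_circuit C \<longleftrightarrow> (\<forall>g \<in> set (gates C). valid_gate (width C) g)"
  by (simp add: valid_circuit_def valid_gate_def)

lemma apply_Hadamard:
  "apply_gate (Hadamard i) \<psi> x =
     ((if bit x i then - 1 else 1) * \<psi> x + \<psi> (flip_bit i x)) / sqrt 2"
proof (cases "bit x i")
  case True
  then have "set_bit i x = x" "unset_bit i x = flip_bit i x"
    by (auto intro!: bit_eqI simp: bit_set_bit_iff bit_unset_bit_iff bit_flip_bit_iff)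
  then show ?thesis using True by simp
next
  case False
  then have "unset_bit i x = x" "set_bit i x = flip_bit i x"
    by (auto intro!: bit_eqI simp: bit_set_bit_iff bit_unset_bit_iff bit_flip_bit_iff)
  then show ?thesis using False by simp
qed

declare apply_gate.simps(1) [simp del] apply_Hadamard [simp]

text \<open>The identity is a junk value for the gates that are not classical.\<close>

fun gate_perm :: "gate \<Rightarrow> nat \<Rightarrow> nat" where
  "gate_perm (CNOT a i) x = (if bit x a then flip_bit i x else x)"
| "gate_perm (Toffoli a b i) x = (if bit x a \<and> bit x b then flip_bit i x else x)"
| "gate_perm _ x = x"

fun classical :: "gate \<Rightarrow> bool" where
  "classical (CNOT _ _) = True"
| "classical (Toffoli _ _ _) = True"
| "classical _ = False"

lemma apply_classical: "classical g \<Longrightarrow> apply_gate g \<psi> = (\<lambda>x. \<psi> (gate_perm g x))"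
  by (cases g) auto

lemma gate_perm_invol: "distinct (gate_qubits g) \<Longrightarrow> gate_perm g (gate_perm g x) = x"
  by (cases g) (auto simp: bit_flip_bit_iff)

lemma gate_perm_less: "valid_gate w g \<Longrightarrow> gate_perm g x < 2 ^ w \<longleftrightarrow> x < 2 ^ w"
  by (cases g) (auto simp: valid_gate_def flip_bit_less)

lemma sum_involution:
  assumes "\<And>x. x \<in> S \<Longrightarrow> p x \<in> S" "\<And>x. x \<in> S \<Longrightarrow> p (p x) = x"
  shows "(\<Sum>x\<in>S. f (p x)) = (\<Sum>x\<in>S. f x)"
  by (rule sum.reindex_bij_witness[of _ p p]) (use assms in auto)

text \<open>\<open>TGate\<close> is the only gate that is not its own inverse. Its adjoint is a map
  on vectors, not a gate, because the gate set contains no inverse of T.\<close>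

fun adjoint_gate :: "gate \<Rightarrow> qvec \<Rightarrow> qvec" where
  "adjoint_gate (TGate i) \<psi> = (\<lambda>x. (if bit x i then cis (- pi / 4) else 1) * \<psi> x)"
| "adjoint_gate g \<psi> = apply_gate g \<psi>"

lemma adjoint_classical: "classical g \<Longrightarrow> adjoint_gate g \<psi> = (\<lambda>x. \<psi> (gate_perm g x))"
  by (cases g) auto

definition inner_w :: "nat \<Rightarrow> qvec \<Rightarrow> qvec \<Rightarrow> complex" where
  "inner_w w \<phi> \<psi> = (\<Sum>x<2 ^ w. cnj (\<phi> x) * \<psi> x)"

text \<open>Classical gates are involutive permutations of the basis, so reindexing moves them
  across. T contributes a phase that conjugation inverts. Hadamard is a signed diagonal plus a bit
  flip, and both terms are symmetric.\<close>

lemma inner_adjoint_gate: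
  assumes "valid_gate w g"
  shows "inner_w w (apply_gate g \<phi>) \<psi> = inner_w w \<phi> (adjoint_gate g \<psi>)"
proof -
  consider "classical g" | i where "g = TGate i" | i where "g = Hadamard i"
    by (cases g) auto
  then show ?thesis
  proof cases
    case 1
    have "inner_w w \<phi> (adjoint_gate g \<psi>) =
        (\<Sum>x<2 ^ w. cnj (\<phi> (gate_perm g (gate_perm g x))) * \<psi> (gate_perm g x))"
      using 1 assms by (simp add: inner_w_def adjoint_classical gate_perm_invol valid_gate_def)
    also have "\<dots> = (\<Sum>x<2 ^ w. cnj (\<phi> (gate_perm g x)) * \<psi> x)"
      by (rule sum_involution)
        (use assms gate_perm_less[OF assms] in \<open>auto simp: gate_perm_invol valid_gate_def\<close>)
    finally show ?thesis using 1 by (simp add: inner_w_def apply_classical)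
  next
    case 2
    show ?thesis unfolding inner_w_def 2
      by (rule sum.cong) (auto simp: cis_cnj)
  next
    case 3
    with assms have i: "i < w" by (simp add: valid_gate_def)
    let ?s = "\<lambda>x. (if bit x i then - 1 else 1) :: complex"
    have "(\<Sum>x<2 ^ w. cnj (\<phi> (flip_bit i x)) * \<psi> x) =
        (\<Sum>x<2 ^ w. cnj (\<phi> (flip_bit i (flip_bit i x))) * \<psi> (flip_bit i x))"
      by (rule sum_involution[symmetric]) (auto simp: flip_bit_less i)
    then have flip: "(\<Sum>x<2 ^ w. cnj (\<phi> (flip_bit i x)) * \<psi> x) =
        (\<Sum>x<2 ^ w. cnj (\<phi> x) * \<psi> (flip_bit i x))" by simp
    have "inner_w w (apply_gate g \<phi>) \<psi> =
        (\<Sum>x<2 ^ w. ?s x * cnj (\<phi> x) * \<psi> x / sqrt 2 + cnj (\<phi> (flip_bit i x)) * \<psi> x / sqrt 2)"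
      unfolding inner_w_def 3 by (rule sum.cong) (auto simp: algebra_simps diff_divide_distrib add_divide_distrib)
    also have "\<dots> = (\<Sum>x<2 ^ w. ?s x * cnj (\<phi> x) * \<psi> x / sqrt 2 + cnj (\<phi> x) * \<psi> (flip_bit i x) / sqrt 2)"
      using flip by (simp add: sum.distrib flip: sum_divide_distrib)
    also have "\<dots> = inner_w w \<phi> (adjoint_gate g \<psi>)"
      unfolding inner_w_def 3 by (rule sum.cong) (auto simp: algebra_simps diff_divide_distrib add_divide_distrib)
    finally show ?thesis .
  qed
qed

lemma sqrt2_mult [simp]: "complex_of_real (sqrt 2) * complex_of_real (sqrt 2) = 2"
  by (metis of_real_mult of_real_numeral real_sqrt_mult_self abs_numeral)

lemma adjoint_apply_gate:
  assumes "distinct (gate_qubits g)"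
  shows "adjoint_gate g (apply_gate g \<psi>) = \<psi>"
proof -
  consider "classical g" | i where "g = TGate i" | i where "g = Hadamard i"
    by (cases g) auto
  then show ?thesis
  proof cases
    case 1
    then show ?thesis
      using assms by (simp add: adjoint_classical apply_classical gate_perm_invol)
  next
    case 2
    then show ?thesis by (auto simp: fun_eq_iff cis_mult simp flip: mult.assoc)
  next
    case 3
    then show ?thesis
      by (auto simp: fun_eq_iff bit_flip_bit_iff add_divide_distrib diff_divide_distrib)
  qed
qed

section \<open>Norm, support and purity under gates\<close>

definition norm2 :: "nat \<Rightarrow> qvec \<Rightarrow> real" where
  "norm2 w \<psi> = (\<Sum>x<2 ^ w. (cmod (\<psi> x))\<^sup>2)"

lemma inner_self: "inner_w w \<psi> \<psi> = complex_of_real (norm2 w \<psi>)"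
  unfolding inner_w_def norm2_def of_real_sum
  by (rule sum.cong) (simp_all only: complex_norm_square mult.commute)

lemma norm2_gate:
  assumes "valid_gate w g"
  shows "norm2 w (apply_gate g \<psi>) = norm2 w \<psi>"
proof -
  have "inner_w w (apply_gate g \<psi>) (apply_gate g \<psi>) = inner_w w \<psi> \<psi>"
    using assms by (simp add: inner_adjoint_gate adjoint_apply_gate valid_gate_def)
  then show ?thesis by (simp add: inner_self)
qed

abbreviation run_gates :: "gate list \<Rightarrow> qvec \<Rightarrow> qvec" where
  "run_gates \<equiv> fold apply_gate"

lemma norm2_run:
  "\<forall>g \<in> set gs. valid_gate w g \<Longrightarrow> norm2 w (run_gates gs \<psi>) = norm2 w \<psi>"
  by (induction gs arbitrary: \<psi>) (auto simp: norm2_gate)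

lemma inner_adjoint_run:
  "\<forall>g \<in> set gs. valid_gate w g \<Longrightarrow>
     inner_w w (run_gates gs \<phi>) \<psi> = inner_w w \<phi> (fold adjoint_gate (rev gs) \<psi>)"
  by (induction gs arbitrary: \<phi>) (auto simp: inner_adjoint_gate)

definition supported :: "nat \<Rightarrow> qvec \<Rightarrow> bool" where
  "supported w \<psi> \<longleftrightarrow> (\<forall>x \<ge> 2 ^ w. \<psi> x = 0)"

lemma supported_gate:
  assumes "valid_gate w g" "supported w \<psi>"
  shows "supported w (apply_gate g \<psi>)"
proof -
  consider "classical g" | i where "g = TGate i" | i where "g = Hadamard i"
    by (cases g) auto
  then show ?thesis
  proof cases
    case 1
    with assms show ?thesis
      using gate_perm_less[OF assms(1)] by (simp add: apply_classical supported_def flip: not_less)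
  next
    case 2
    with assms show ?thesis by (simp add: supported_def)
  next
    case 3
    with assms show ?thesis
      by (auto simp: supported_def valid_gate_def flip_bit_less simp flip: not_less)
  qed
qed

lemma supported_run:
  "\<forall>g \<in> set gs. valid_gate w g \<Longrightarrow> supported w \<psi> \<Longrightarrow> supported w (run_gates gs \<psi>)"
  by (induction gs arbitrary: \<psi>) (auto simp: supported_gate)

lemma pure_states_iff: "\<psi> \<in> pure_states w \<longleftrightarrow> supported w \<psi> \<and> norm2 w \<psi> = 1"
  by (auto simp: pure_states_def supported_def norm2_def)

lemma pure_states_run:
  "\<forall>g \<in> set gs. valid_gate w g \<Longrightarrow> \<psi> \<in> pure_states w \<Longrightarrow> run_gates gs \<psi> \<in> pure_states w"
  by (simp add: pure_states_iff supported_run norm2_run)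

lemma inner_ket0: "inner_w w ket0 \<psi> = \<psi> 0"
proof -
  have "inner_w w ket0 \<psi> = (\<Sum>x<2 ^ w. if x = 0 then \<psi> x else 0)"
    unfolding inner_w_def by (rule sum.cong) (auto simp: ket0_def)
  then show ?thesis by simp
qed

lemma ket0_pure: "ket0 \<in> pure_states w"
  using inner_ket0[of w ket0]
  by (auto simp: pure_states_iff supported_def inner_self ket0_def)

lemma gen_state_pure:
  assumes "valid_circuit (G k)"
  shows "gen_state G k \<in> pure_states (width (G k))"
  using assms pure_states_run[OF _ ket0_pure]
  by (simp add: gen_state_def run_circuit_def valid_circuit_iff)

text \<open>Moving the preparation circuit to the other argument of the inner product leaves
  \<open>ket0\<close> behind, so the projective test becomes: undo the circuit and look for the
  all-zero state.\<close>

lemma overlap_gen_state: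
  assumes "valid_circuit (G k)" "width (G k) = w"
  shows "overlap w (gen_state G k) \<psi> = (cmod (fold adjoint_gate (rev (gates (G k))) \<psi> 0))\<^sup>2"
  using assms inner_adjoint_run[of "gates (G k)" w ket0 \<psi>]
  unfolding overlap_def gen_state_def run_circuit_def
  by (auto simp: inner_ket0 valid_circuit_iff simp flip: inner_w_def)

section \<open>Tensor products\<close>

lemma take_bit_flip_bit_le [simp]: "k \<le> i \<Longrightarrow> take_bit k (flip_bit i x) = take_bit k (x :: nat)"
  by (rule bit_eqI) (auto simp: bit_flip_bit_iff bit_take_bit_iff)

lemma take_bit_flip_bit_less: "i < k \<Longrightarrow> take_bit k (flip_bit i x) = flip_bit i (take_bit k (x :: nat))"
  by (rule bit_eqI) (auto simp: bit_flip_bit_iff bit_take_bit_iff)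

lemma drop_bit_flip_bit_less [simp]: "i < k \<Longrightarrow> drop_bit k (flip_bit i x) = drop_bit k (x :: nat)"
  by (rule bit_eqI) (auto simp: bit_flip_bit_iff bit_drop_bit_eq)

lemma drop_bit_flip_bit_add [simp]:
  "drop_bit k (flip_bit (k + i) x) = flip_bit i (drop_bit k (x :: nat))"
  by (rule bit_eqI) (auto simp: bit_flip_bit_iff bit_drop_bit_eq)

fun shift_gate :: "nat \<Rightarrow> gate \<Rightarrow> gate" where
  "shift_gate k (Hadamard i) = Hadamard (k + i)"
| "shift_gate k (TGate i) = TGate (k + i)"
| "shift_gate k (CNOT a i) = CNOT (k + a) (k + i)"
| "shift_gate k (Toffoli a b i) = Toffoli (k + a) (k + b) (k + i)"

lemma valid_shift_gate: "valid_gate w g \<Longrightarrow> valid_gate (k + w) (shift_gate k g)"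
  by (cases g) (auto simp: valid_gate_def)

lemma valid_gate_mono: "valid_gate w g \<Longrightarrow> w \<le> w' \<Longrightarrow> valid_gate w' g"
  by (auto simp: valid_gate_def)

lemma apply_shift_gate:
  "apply_gate (shift_gate k g) (tensor k \<psi> \<phi>) = tensor k \<psi> (apply_gate g \<phi>)"
  by (cases g) (auto simp: tensor_def fun_eq_iff bit_drop_bit_eq ring_distribs mult.left_commute)

lemma run_shift_gate:
  "run_gates (map (shift_gate k) gs) (tensor k \<psi> \<phi>) = tensor k \<psi> (run_gates gs \<phi>)"
  by (induction gs arbitrary: \<phi>) (auto simp: apply_shift_gate)

lemma tensor_assoc: "tensor k \<psi> (tensor l \<xi> \<phi>) = tensor (k + l) (tensor k \<psi> \<xi>) \<phi>"
proof
  fix x :: nat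
  have "take_bit k (take_bit (k + l) x) = take_bit k x"
    "drop_bit k (take_bit (k + l) x) = take_bit l (drop_bit k x)"
    "drop_bit l (drop_bit k x) = drop_bit (k + l) x"
    by (auto intro!: bit_eqI simp: bit_take_bit_iff bit_drop_bit_eq algebra_simps)
  then show "tensor k \<psi> (tensor l \<xi> \<phi>) x = tensor (k + l) (tensor k \<psi> \<xi>) \<phi> x"
    by (simp add: tensor_def)
qed

lemma copies_Suc: "copies m (Suc t) \<psi> = tensor m \<psi> (copies m t \<psi>)"
  by (simp add: copies_def)

lemma copies_add: "copies m (s + t) \<psi> = tensor (s * m) (copies m s \<psi>) (copies m t \<psi>)"
proof (induction s)
  case 0
  show ?case by (auto simp: copies_def tensor_def ket0_def fun_eq_iff)
next
  case (Suc s)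
  then show ?case by (simp add: copies_Suc tensor_assoc)
qed

text \<open>Every index below \<open>2 ^ (k + l)\<close> is uniquely \<open>a + 2 ^ k * b\<close>.
  Besides norms of tensor products, this separates the registers when probabilities are
  summed.\<close>

lemma sum_tensor_split:
  fixes f :: "nat \<Rightarrow> nat \<Rightarrow> 'a :: comm_monoid_add"
  shows "(\<Sum>x<2 ^ (k + l). f (take_bit k x) (drop_bit k x)) = (\<Sum>a<2 ^ k. \<Sum>b<2 ^ l. f a b)"
proof -
  have "(\<Sum>x<2 ^ (k + l). f (take_bit k x) (drop_bit k x)) =
      (\<Sum>(a, b) \<in> {..<2 ^ k} \<times> {..<2 ^ l}. f a b)"
  proof (rule sum.reindex_bij_witness[where j = "\<lambda>x. (take_bit k x, drop_bit k x)"
        and i = "\<lambda>(a, b). a + 2 ^ k * b"])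
    fix x :: nat assume x: "x \<in> {..<2 ^ (k + l)}"
    show "(case (take_bit k x, drop_bit k x) of (a, b) \<Rightarrow> a + 2 ^ k * b) = x"
      by (simp add: take_bit_eq_mod drop_bit_eq_div)
    have "x < 2 ^ l * 2 ^ k" using x by (simp add: power_add mult.commute)
    then have "drop_bit k x < 2 ^ l"
      by (simp add: drop_bit_eq_div less_mult_imp_div_less)
    then show "(take_bit k x, drop_bit k x) \<in> {..<2 ^ k} \<times> {..<2 ^ l}" by simp
  next
    fix ab :: "nat \<times> nat" assume ab: "ab \<in> {..<2 ^ k} \<times> {..<2 ^ l}"
    obtain a b where [simp]: "ab = (a, b)" by (cases ab)
    show "(take_bit k (case ab of (a, b) \<Rightarrow> a + 2 ^ k * b),
        drop_bit k (case ab of (a, b) \<Rightarrow> a + 2 ^ k * b)) = ab"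
      using ab by (simp add: take_bit_eq_mod drop_bit_eq_div)
    have "a + 2 ^ k * b < 2 ^ k + 2 ^ k * b" using ab by simp
    also have "\<dots> = 2 ^ k * (b + 1)" by simp
    also have "\<dots> \<le> 2 ^ k * 2 ^ l" using ab by (intro mult_le_mono2) auto
    finally show "(case ab of (a, b) \<Rightarrow> a + 2 ^ k * b) \<in> {..<2 ^ (k + l)}"
      by (simp add: power_add)
  qed auto
  then show ?thesis by (simp add: sum.cartesian_product)
qed

lemma supported_tensor:
  assumes "supported l \<phi>"
  shows "supported (k + l) (tensor k \<psi> \<phi>)"
  unfolding supported_def
proof (intro allI impI)
  fix x :: nat assume "2 ^ (k + l) \<le> x"
  then have "2 ^ l \<le> drop_bit k x"
    by (simp add: drop_bit_eq_div power_add less_eq_div_iff_mult_less_eq mult.commute)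
  then show "tensor k \<psi> \<phi> x = 0" using assms by (simp add: supported_def tensor_def)
qed

lemma norm2_tensor: "norm2 (k + l) (tensor k \<psi> \<phi>) = norm2 k \<psi> * norm2 l \<phi>"
  using sum_tensor_split[where k = k and l = l and f = "\<lambda>a b. (cmod (\<psi> a))\<^sup>2 * (cmod (\<phi> b))\<^sup>2"]
  by (simp add: norm2_def tensor_def norm_mult power_mult_distrib sum_product)

lemma copies_pure:
  assumes "\<psi> \<in> pure_states m"
  shows "copies m t \<psi> \<in> pure_states (t * m)"
proof (induction t)
  case 0
  show ?case using ket0_pure[of 0] by (simp add: copies_def)
next
  case (Suc t)
  with assms show ?case
    by (auto simp: copies_Suc pure_states_iff intro: supported_tensor) (simp add: norm2_tensor)
qed

lemma supported_mono: "supported w \<psi> \<Longrightarrow> w \<le> w' \<Longrightarrow> supported w' \<psi>"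
  unfolding supported_def by (meson le_trans one_le_numeral power_increasing)

lemma norm2_mono:
  assumes "supported w \<psi>" "w \<le> w'"
  shows "norm2 w' \<psi> = norm2 w \<psi>"
  unfolding norm2_def
proof (rule sum.mono_neutral_right)
  show "{..<2 ^ w} \<subseteq> {..<(2 :: nat) ^ w'}"
    using power_increasing[OF assms(2), of "2 :: nat"] by auto
  show "\<forall>i\<in>{..<2 ^ w'} - {..<2 ^ w}. (cmod (\<psi> i))\<^sup>2 = 0"
    using assms(1) by (auto simp: supported_def)
qed simp

lemma pure_states_mono: "\<psi> \<in> pure_states w \<Longrightarrow> w \<le> w' \<Longrightarrow> \<psi> \<in> pure_states w'"
  by (metis pure_states_iff norm2_mono supported_mono)

section \<open>Classical reversible circuits\<close>

text \<open>\<open>apply_gate\<close> pulls amplitudes back along \<open>gate_perm\<close>. As that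
  is an involution, the amplitude at \<open>x\<close> travels forward to the image of
  \<open>x\<close>, with the gates in execution order.\<close>

lemma run_classical:
  assumes "\<forall>g \<in> set gs. classical g \<and> distinct (gate_qubits g)"
  shows "run_gates gs \<psi> (fold gate_perm gs x) = \<psi> x"
  using assms by (induction gs arbitrary: \<psi> x) (auto simp: apply_classical gate_perm_invol)

lemma bij_betw_gate_perm:
  assumes "valid_gate w g"
  shows "bij_betw (gate_perm g) {..<2 ^ w} {..<2 ^ w}"
  by (rule bij_betw_byWitness[where f' = "gate_perm g"])
    (use assms in \<open>auto simp: gate_perm_invol gate_perm_less valid_gate_def\<close>)

lemma bij_betw_classical:
  "\<forall>g \<in> set gs. valid_gate w g \<Longrightarrow> bij_betw (fold gate_perm gs) {..<2 ^ w} {..<2 ^ w}"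
proof (induction gs)
  case Nil
  show ?case by (simp add: bij_betw_def)
next
  case (Cons g gs)
  then have "bij_betw (fold gate_perm gs \<circ> gate_perm g) {..<2 ^ w} {..<2 ^ w}"
    by (intro bij_betw_trans[OF bij_betw_gate_perm]) auto
  then show ?case by (simp add: comp_def)
qed

text \<open>
  A program over wires \<open>'w\<close>: each wire of the list \<open>ls\<close> becomes the exclusive or of the
  conjunctions of the pairs of wires listed in its definition.
\<close>

definition prog_gates :: "('w \<Rightarrow> nat) \<Rightarrow> ('w \<Rightarrow> ('w \<times> 'w) list) \<Rightarrow> 'w list \<Rightarrow> gate list" where
  "prog_gates pos df ls =
     concat (map (\<lambda>l. map (\<lambda>(a, b). Toffoli (pos a) (pos b) (pos l)) (df l)) ls)"

text \<open>No control is the target, so the controls keep their values and each pair with both bits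
  set toggles the target once.\<close>

lemma bit_fold_Toffoli:
  assumes "\<forall>(a, b) \<in> set ds. pos a \<noteq> t \<and> pos b \<noteq> t"
  shows "bit (fold gate_perm (map (\<lambda>(a, b). Toffoli (pos a) (pos b) t) ds) x) i =
    (if i = t then bit x t \<noteq> odd (length (filter (\<lambda>(a, b). bit x (pos a) \<and> bit x (pos b)) ds))
     else bit x i)"
  using assms
proof (induction ds arbitrary: x)
  case Nil
  then show ?case by simp
next
  case (Cons d ds)
  obtain a b where d: "d = (a, b)" by (cases d)
  define y where "y = gate_perm (Toffoli (pos a) (pos b) t) x"
  have y: "bit y j = (if j = t then bit x t \<noteq> (bit x (pos a) \<and> bit x (pos b)) else bit x j)" for j
    by (auto simp: y_def bit_flip_bit_iff)
  have "filter (\<lambda>(a, b). bit y (pos a) \<and> bit y (pos b)) ds =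
      filter (\<lambda>(a, b). bit x (pos a) \<and> bit x (pos b)) ds"
    using Cons.prems by (intro filter_cong) (auto simp: y)
  then show ?case
    using Cons.IH[of y] Cons.prems by (simp add: d y del: gate_perm.simps flip: y_def) auto
qed

text \<open>Each target starts at 0, is written at one place and read only afterwards, so the
  defining equations determine all wires from the inputs. A proposed meaning \<open>val\<close>
  therefore only has to satisfy these equations, one wire at a time.\<close>

lemma bit_prog_gates:
  assumes "inj_on pos (I \<union> set ls)" "distinct ls" "I \<inter> set ls = {}"
    and "\<And>us l vs a b. ls = us @ l # vs \<Longrightarrow> (a, b) \<in> set (df l) \<Longrightarrow> a \<in> I \<union> set us \<and> b \<in> I \<union> set us"
    and "\<And>l. l \<in> set ls \<Longrightarrow> val l \<longleftrightarrow> odd (length (filter (\<lambda>(a, b). val a \<and> val b) (df l)))"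
    and "\<And>a. a \<in> I \<Longrightarrow> bit x (pos a) \<longleftrightarrow> val a"
    and "\<And>l. l \<in> set ls \<Longrightarrow> \<not> bit x (pos l)"
  shows "(\<forall>l \<in> I \<union> set ls. bit (fold gate_perm (prog_gates pos df ls) x) (pos l) \<longleftrightarrow> val l) \<and>
    (\<forall>i. i \<notin> pos ` set ls \<longrightarrow> bit (fold gate_perm (prog_gates pos df ls) x) i = bit x i)"
  using assms
proof (induction ls rule: rev_induct)
  case Nil
  then show ?case by (simp add: prog_gates_def)
next
  case (snoc l ls)
  define y where "y = fold gate_perm (prog_gates pos df ls) x"
  have IH: "(\<forall>l \<in> I \<union> set ls. bit y (pos l) \<longleftrightarrow> val l) \<and>
      (\<forall>i. i \<notin> pos ` set ls \<longrightarrow> bit y i = bit x i)"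
    unfolding y_def
  proof (rule snoc.IH)
    show "inj_on pos (I \<union> set ls)"
      by (rule inj_on_subset[OF snoc.prems(1)]) auto
    show "a \<in> I \<union> set us \<and> b \<in> I \<union> set us"
      if "ls = us @ l' # vs" "(a, b) \<in> set (df l')" for us l' vs a b
      using snoc.prems(4)[of us l' "vs @ [l]" a b] that by simp
  qed (use snoc.prems in auto)
  have ctrl: "a \<in> I \<union> set ls \<and> b \<in> I \<union> set ls" if "(a, b) \<in> set (df l)" for a b
    using snoc.prems(4)[of ls l "[]" a b] that by simp
  have l: "l \<notin> I \<union> set ls" using snoc.prems by auto
  have neq: "pos a \<noteq> pos l" if "a \<in> I \<union> set ls" for a
  proof
    assume "pos a = pos l"
    with that have "a = l" by (intro inj_onD[OF snoc.prems(1)]) auto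
    with l that show False by simp
  qed
  have "pos l \<notin> pos ` set ls" using neq by force
  then have "\<not> bit y (pos l)" using IH snoc.prems(7)[of l] by simp
  have fl: "filter (\<lambda>(a, b). bit y (pos a) \<and> bit y (pos b)) (df l) =
      filter (\<lambda>(a, b). val a \<and> val b) (df l)"
    using ctrl IH by (intro filter_cong) auto
  have z: "fold gate_perm (prog_gates pos df (ls @ [l])) x =
      fold gate_perm (map (\<lambda>(a, b). Toffoli (pos a) (pos b) (pos l)) (df l)) y"
    by (simp add: prog_gates_def y_def)
  have bit_z: "bit (fold gate_perm (prog_gates pos df (ls @ [l])) x) i =
      (if i = pos l then val l else bit y i)" for i
    unfolding z
    by (subst bit_fold_Toffoli)
      (use ctrl neq \<open>\<not> bit y (pos l)\<close> snoc.prems(5)[of l] in \<open>auto simp: fl\<close>)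
  show ?case
    unfolding bit_z using IH neq by auto
qed

lemma obtain_sorted_list:
  fixes f :: "'w \<Rightarrow> nat"
  assumes "finite W"
  obtains ls where "set ls = W" "distinct ls" "sorted (map f ls)"
proof -
  obtain xs where "set xs = W" "distinct xs" using finite_distinct_list[OF assms] by blast
  then show thesis using that[of "sort_key f xs"] by simp
qed

text \<open>Used with \<open>depth\<close>: sorting the wires by it gives an order in which every
  control precedes its target.\<close>

lemma sorted_rank_prefix:
  fixes f :: "'w \<Rightarrow> nat"
  assumes "sorted (map f (us @ l # vs))" "a \<in> set (us @ l # vs)" "f a < f l"
  shows "a \<in> set us"
  using assms by (auto simp: sorted_append)

section \<open>Controlled gates\<close>

text \<open>
  The control is \<open>c\<close>, and \<open>d\<close> is an ancilla in state 0.  The Hadamard gate is the conjugate of the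
  NOT gate by \<open>S H T\<close>, where \<open>S = T^2\<close>; the inverses of \<open>S\<close> and \<open>T\<close> are \<open>T^6\<close> and \<open>T^7\<close>.
\<close>

fun controlled_adjoint :: "nat \<Rightarrow> nat \<Rightarrow> gate \<Rightarrow> gate list" where
  "controlled_adjoint c d (Hadamard i) =
     replicate 6 (TGate i) @ [Hadamard i] @ replicate 7 (TGate i) @ [CNOT c i, TGate i, Hadamard i] @
     replicate 2 (TGate i)"
| "controlled_adjoint c d (TGate i) = [Toffoli c i d] @ replicate 7 (TGate d) @ [Toffoli c i d]"
| "controlled_adjoint c d (CNOT a i) = [Toffoli c a i]"
| "controlled_adjoint c d (Toffoli a b i) = [Toffoli c a d, Toffoli d b i, Toffoli c a d]"

lemma run_TGate_power:
  "run_gates (replicate k (TGate i)) \<psi> = (\<lambda>x. (if bit x i then cis (k * pi / 4) else 1) * \<psi> x)"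
proof (induction k arbitrary: \<psi>)
  case 0
  show ?case by auto
next
  case (Suc k)
  have "cis (Suc k * pi / 4) = cis (k * pi / 4) * cis (pi / 4)"
    by (simp add: cis_mult add_divide_distrib distrib_right add.commute)
  moreover have "run_gates (replicate (Suc k) (TGate i)) \<psi> =
      run_gates (replicate k (TGate i)) (apply_gate (TGate i) \<psi>)"
    by (simp only: replicate_Suc fold_Cons comp_apply)
  ultimately show ?case by (simp add: Suc fun_eq_iff del: fold_replicate)
qed

lemma cis_quarters:
  "cis (pi / 4) = (1 + \<i>) / sqrt 2" "cis (7 * pi / 4) = (1 - \<i>) / sqrt 2"
  "cis (6 * pi / 4) = - \<i>" "cis (2 * pi / 4) = \<i>"
proof -
  have r: "sqrt 2 / 2 = 1 / sqrt 2" by (simp add: divide_eq_eq eq_divide_eq)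
  show 1: "cis (pi / 4) = (1 + \<i>) / sqrt 2"
    by (simp add: complex_eq_iff cos_45 sin_45 r)
  have "7 * pi / 4 = 2 * pi + - (pi / 4)" by simp
  then have "cis (7 * pi / 4) = cnj (cis (pi / 4))"
    by (simp only: cis_mult[symmetric] cis_2pi cis_cnj) simp
  then show "cis (7 * pi / 4) = (1 - \<i>) / sqrt 2" by (simp add: 1)
  have "6 * pi / 4 = pi + pi / 2" by simp
  then show "cis (6 * pi / 4) = - \<i>" by (simp only: cis_mult[symmetric] cis_pi cis_pi_half) simp
  have "2 * pi / 4 = pi / 2" by simp
  then show "cis (2 * pi / 4) = \<i>" by (simp only: cis_pi_half)
qed

definition clean :: "nat \<Rightarrow> qvec \<Rightarrow> bool" where
  "clean d \<psi> \<longleftrightarrow> (\<forall>x. bit x d \<longrightarrow> \<psi> x = 0)"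

text \<open>The control bit is the same at \<open>x\<close> and \<open>flip_bit i x\<close>, so the
  sequence acts on this pair of amplitudes alone. With control 0 the two halves of the conjugation
  cancel; with control 1 they turn NOT into Hadamard.\<close>

lemma controlled_adjoint_Hadamard:
  assumes "i \<noteq> c"
  shows "run_gates (controlled_adjoint c d (Hadamard i)) \<psi> =
    (\<lambda>x. if bit x c then apply_gate (Hadamard i) \<psi> x else \<psi> x)"
proof
  fix x :: nat
  have powers: "run_gates (replicate 6 (TGate i)) \<psi> = (\<lambda>x. (if bit x i then - \<i> else 1) * \<psi> x)"
    "run_gates (replicate 7 (TGate i)) \<psi> = (\<lambda>x. (if bit x i then (1 - \<i>) / sqrt 2 else 1) * \<psi> x)"
    "run_gates (replicate 2 (TGate i)) \<psi> = (\<lambda>x. (if bit x i then \<i> else 1) * \<psi> x)" for \<psi>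
    unfolding run_TGate_power of_nat_numeral cis_quarters by (rule refl)+
  have s: "complex_of_real (sqrt 2) * (complex_of_real (sqrt 2) * z) = 2 * z" for z
    by (simp flip: mult.assoc)
  show "run_gates (controlled_adjoint c d (Hadamard i)) \<psi> x =
    (if bit x c then apply_gate (Hadamard i) \<psi> x else \<psi> x)"
    using assms
    apply (simp only: controlled_adjoint.simps fold_append comp_apply powers)
    apply (simp add: bit_flip_bit_iff cis_quarters)
    apply (simp add: divide_simps)
    apply (simp add: algebra_simps s)
    done
qed


text \<open>For T and Toffoli, the conjunction of the control with one more qubit is computed into
  the clean ancilla \<open>d\<close>, used there and uncomputed. For T the use is the phase gate
  \<open>T^7\<close>, the inverse of T.\<close>

lemma run_controlled_adjoint:
  assumes "valid_gate m g" "m \<le> c" "m \<le> d" "c \<noteq> d" "clean d \<psi>"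
  shows "run_gates (controlled_adjoint c d g) \<psi> =
    (\<lambda>x. if bit x c then adjoint_gate g \<psi> x else \<psi> x)"
proof (cases g)
  case (Hadamard i)
  then have "i \<noteq> c" using assms by (auto simp: valid_gate_def)
  then show ?thesis unfolding Hadamard by (subst controlled_adjoint_Hadamard) (simp_all only: adjoint_gate.simps not_False_eq_True)
next
  case (TGate i)
  have "7 * pi / 4 = 2 * pi + - pi / 4" by simp
  then have c7: "cis (7 * pi / 4) = cis (- pi / 4)"
    by (simp only: cis_mult[symmetric] cis_2pi) simp
  have powers: "run_gates (replicate 7 (TGate d)) \<psi> =
      (\<lambda>x. (if bit x d then cis (- pi / 4) else 1) * \<psi> x)" for \<psi>
    unfolding run_TGate_power of_nat_numeral c7 by (rule refl)+
  show ?thesis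
    using assms TGate
    by (simp only: controlled_adjoint.simps fold_append comp_apply powers)
      (auto simp: fun_eq_iff bit_flip_bit_iff valid_gate_def clean_def)
next
  case (CNOT a i)
  then show ?thesis by auto
next
  case (Toffoli a b i)
  then show ?thesis using assms
    by (auto simp: fun_eq_iff bit_flip_bit_iff valid_gate_def clean_def)
      (auto intro!: arg_cong[of _ _ \<psi>] bit_eqI simp: bit_flip_bit_iff)
qed

text \<open>Unlike in \<open>tensor\<close>, the vector on the low \<open>m\<close> qubits may
  depend on the value of the remaining ones; this is how branches with different gate lists are
  described.\<close>

definition blocks :: "nat \<Rightarrow> (nat \<Rightarrow> qvec) \<Rightarrow> qvec" where
  "blocks m F = (\<lambda>x. F (drop_bit m x) (take_bit m x))"

lemma adjoint_gate_blocks: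
  assumes "valid_gate m g"
  shows "adjoint_gate g (blocks m F) = blocks m (\<lambda>u. adjoint_gate g (F u))"
  using assms
  by (cases g) (auto simp: blocks_def fun_eq_iff bit_take_bit_iff valid_gate_def
      take_bit_flip_bit_less)

lemma adjoint_gate_scale:
  "adjoint_gate g (\<lambda>a. z * \<psi> a) = (\<lambda>a. z * adjoint_gate g \<psi> a)"
  by (cases g) (auto simp: fun_eq_iff ring_distribs)

lemma fold_adjoint_scale:
  "fold adjoint_gate gs (\<lambda>a. z * \<psi> a) = (\<lambda>a. z * fold adjoint_gate gs \<psi> a)"
  by (induction gs arbitrary: \<psi>) (auto simp: adjoint_gate_scale)

definition controlled_gates :: "nat \<Rightarrow> nat \<Rightarrow> (nat \<times> gate) list \<Rightarrow> gate list" where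
  "controlled_gates m d cs = concat (map (\<lambda>(c, g). controlled_adjoint (m + c) (m + d) g) cs)"

text \<open>The controls belong to the block index, which these gates leave unchanged, so each block
  undergoes exactly the gates that its index selects. The vanishing blocks express that the ancilla
  \<open>d\<close> is clean.\<close>

lemma run_controlled_gates:
  assumes "\<forall>(c, g) \<in> set cs. valid_gate m g \<and> c \<noteq> d" "\<And>u. bit u d \<Longrightarrow> F u = (\<lambda>_. 0)"
  shows "run_gates (controlled_gates m d cs) (blocks m F) =
    blocks m (\<lambda>u. fold adjoint_gate (map snd (filter (\<lambda>(c, g). bit u c) cs)) (F u))"
  using assms
proof (induction cs arbitrary: F)
  case Nil
  show ?case by (simp add: controlled_gates_def)
next
  case (Cons cg cs)
  obtain c g where cg: "cg = (c, g)" by (cases cg)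
  let ?F = "\<lambda>u. if bit u c then adjoint_gate g (F u) else F u"
  have "clean (m + d) (blocks m F)"
    using Cons.prems(2) by (auto simp: clean_def blocks_def bit_drop_bit_eq)
  then have "run_gates (controlled_adjoint (m + c) (m + d) g) (blocks m F) =
      (\<lambda>x. if bit x (m + c) then blocks m (\<lambda>u. adjoint_gate g (F u)) x else blocks m F x)"
    using Cons.prems(1)
    by (subst run_controlled_adjoint[of m]) (auto simp: cg adjoint_gate_blocks cong: if_cong)
  also have "\<dots> = blocks m ?F"
    by (auto simp: blocks_def bit_drop_bit_eq fun_eq_iff)
  finally have "run_gates (controlled_adjoint (m + c) (m + d) g) (blocks m F) = blocks m ?F" .
  \<comment> \<open>By linearity, seen here as scaling by 0, the new family again vanishes wherever
    the ancilla is set.\<close>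
  moreover have "?F u = (\<lambda>_. 0)" if "bit u d" for u
    using Cons.prems(2)[OF that] adjoint_gate_scale[of g 0 "\<lambda>_. 0"] by auto
  ultimately have "run_gates (controlled_gates m d (cg # cs)) (blocks m F) =
      blocks m (\<lambda>u. fold adjoint_gate (map snd (filter (\<lambda>(c, g). bit u c) cs)) (?F u))"
    using Cons.IH[of ?F] Cons.prems(1) by (simp add: controlled_gates_def cg)
  also have "\<dots> = blocks m (\<lambda>u. fold adjoint_gate (map snd (filter (\<lambda>(c, g). bit u c) (cg # cs))) (F u))"
    by (auto simp: blocks_def cg)
  finally show ?case .
qed

lemma valid_controlled_gates:
  assumes "\<forall>(c, g) \<in> set cs. valid_gate m g \<and> c \<noteq> d \<and> c < w" "d < w"
  shows "\<forall>g \<in> set (controlled_gates m d cs). valid_gate (m + w) g"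
proof -
  have "valid_gate (m + w) h" if "valid_gate m g" "c \<noteq> d" "c < w" "h \<in> set (controlled_adjoint (m + c) (m + d) g)" for c g h
    using that \<open>d < w\<close> by (cases g) (auto simp: valid_gate_def)
  then show ?thesis using assms unfolding controlled_gates_def by fastforce
qed

text \<open>The longest replacement is that of Hadamard, with 19 gates.\<close>

lemma length_controlled_gates: "length (controlled_gates m d cs) \<le> 20 * length cs"
proof -
  have "length (controlled_adjoint c d g) \<le> 20" for c d g by (cases g) auto
  then show ?thesis
    unfolding controlled_gates_def
    by (induction cs) (auto simp: algebra_simps intro!: add_mono)
qed

section \<open>Testing a register for zero\<close>

text \<open>The wire \<open>base + j\<close> says that the first \<open>j\<close> qubits are zero.\<close>

fun nor_gates :: "nat \<Rightarrow> nat \<Rightarrow> nat \<Rightarrow> gate list" where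
  "nor_gates one base 0 = [CNOT one base]"
| "nor_gates one base (Suc j) = nor_gates one base j @
     [Toffoli (base + j) one (base + Suc j), Toffoli (base + j) j (base + Suc j)]"

lemma bit_nor_gates:
  assumes "one < base" "m \<le> one" "bit x one" "\<And>i. base \<le> i \<Longrightarrow> \<not> bit x i" "k \<le> m"
  shows "(\<forall>j \<le> k. bit (fold gate_perm (nor_gates one base k) x) (base + j) \<longleftrightarrow> (\<forall>i<j. \<not> bit x i)) \<and>
    (\<forall>i. i \<notin> {base..base + k} \<longrightarrow> bit (fold gate_perm (nor_gates one base k) x) i = bit x i)"
  using assms(5)
proof (induction k)
  case 0
  show ?case using assms by (auto simp: bit_flip_bit_iff)
next
  case (Suc k)
  define y where "y = fold gate_perm (nor_gates one base k) x"
  have y1: "bit y (base + j) \<longleftrightarrow> (\<forall>i<j. \<not> bit x i)" if "j \<le> k" for j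
    using Suc that by (simp add: y_def)
  have y2: "bit y i = bit x i" if "i \<notin> {base..base + k}" for i
    using Suc that by (simp add: y_def)
  have yk: "bit y one" "bit y k = bit x k" "\<not> bit y (base + Suc k)"
    using assms Suc.prems y2[of one] y2[of k] y2[of "base + Suc k"] by auto
  have "bit (fold gate_perm (nor_gates one base (Suc k)) x) i =
      (if i = base + Suc k then (\<forall>i<Suc k. \<not> bit x i) else bit y i)" for i
    using yk y1[of k] assms Suc.prems
    by (auto simp: y_def[symmetric] bit_flip_bit_iff less_Suc_eq)
  then show ?case using y1 y2 by (auto simp: le_Suc_eq)
qed

lemma valid_nor_gates:
  assumes "one < base" "k \<le> one" "base + k < w"
  shows "\<forall>g \<in> set (nor_gates one base k). classical g \<and> valid_gate w g"
  using assms by (induction k) (auto simp: valid_gate_def)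

lemma length_nor_gates: "length (nor_gates one base k) = 2 * k + 1"
  by (induction k) auto

text \<open>Acceptance is read from qubit 0. The final two CNOTs carry the verdict there: the old
  value of qubit 0 is added to the verdict wire, and adding the sum back cancels it.\<close>

definition zero_test :: "nat \<Rightarrow> nat \<Rightarrow> nat \<Rightarrow> gate list" where
  "zero_test one base m = nor_gates one base m @ [CNOT 0 (base + m), CNOT (base + m) 0]"

lemma bit_zero_test:
  assumes "one < base" "m \<le> one" "bit x one" "\<And>i. base \<le> i \<Longrightarrow> \<not> bit x i"
  shows "bit (fold gate_perm (zero_test one base m) x) 0 \<longleftrightarrow> take_bit m x = 0"
proof -
  define y where "y = fold gate_perm (nor_gates one base m) x"
  have "bit (fold gate_perm (zero_test one base m) x) 0 \<longleftrightarrow> bit y (base + m)"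
    using assms(1) by (auto simp: zero_test_def y_def[symmetric] bit_flip_bit_iff)
  also have "\<dots> \<longleftrightarrow> (\<forall>i<m. \<not> bit x i)"
    using bit_nor_gates[OF assms order_refl] by (simp add: y_def)
  also have "\<dots> \<longleftrightarrow> take_bit m x = 0"
    by (simp add: bit_eq_iff bit_take_bit_iff)
  finally show ?thesis .
qed

lemma valid_zero_test:
  assumes "one < base" "m \<le> one" "base + m < w"
  shows "\<forall>g \<in> set (zero_test one base m). classical g \<and> valid_gate w g"
  using valid_nor_gates[OF assms] assms by (auto simp: zero_test_def valid_gate_def)

section \<open>Circuits for classical polynomial time\<close>

text \<open>An exclusive or of mutually exclusive conditions is their disjunction. This lets case
  distinctions be accumulated by Toffoli gates on one target.\<close>

lemma odd_length_filter_unique: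
  assumes "distinct xs" "\<And>x y. x \<in> set xs \<Longrightarrow> y \<in> set xs \<Longrightarrow> P x \<Longrightarrow> P y \<Longrightarrow> x = y"
  shows "odd (length (filter P xs)) \<longleftrightarrow> (\<exists>x \<in> set xs. P x)"
proof (cases "\<exists>x \<in> set xs. P x")
  case True
  then obtain x where "x \<in> set xs" "P x" by blast
  with assms(2) have "{y \<in> set xs. P y} = {x}" by blast
  then have "length (filter P xs) = 1"
    using distinct_card[OF distinct_filter[OF assms(1), of P]] by simp
  with True show ?thesis by simp
next
  case False
  then have "filter P xs = []" by (simp add: filter_empty_conv)
  with False show ?thesis by simp
qed

text \<open>All gates that a circuit on \<open>m\<close> qubits can contain. The parser tries each
  of them at each cell, which is affordable because there are only cubically many; the list is free
  of repetitions so that parities are meaningful.\<close>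

definition gate_list :: "nat \<Rightarrow> gate list" where
  "gate_list m =
     map Hadamard [0..<m] @ map TGate [0..<m] @
     map (\<lambda>(a, i). CNOT a i) (filter (\<lambda>(a, i). a \<noteq> i) (List.product [0..<m] [0..<m])) @
     map (\<lambda>(a, b, i). Toffoli a b i)
       (filter (\<lambda>(a, b, i). a \<noteq> b \<and> a \<noteq> i \<and> b \<noteq> i)
         (List.product [0..<m] (List.product [0..<m] [0..<m])))"

lemma set_gate_list: "set (gate_list m) = {g. valid_gate m g}"
proof (intro set_eqI)
  fix g show "g \<in> set (gate_list m) \<longleftrightarrow> g \<in> {g. valid_gate m g}"
    by (cases g) (auto simp: gate_list_def valid_gate_def image_iff Bex_def)
qed

lemma distinct_gate_list: "distinct (gate_list m)"
  by (auto simp: gate_list_def distinct_map distinct_product inj_on_def intro!: distinct_filter)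

lemma length_gate_list: "length (gate_list m) \<le> 2 * m + m * m + m * (m * m)"
proof -
  have "length (filter P (List.product [0..<m] [0..<m])) \<le> m * m" for P
    by (rule order_trans[OF length_filter_le]) simp
  moreover have "length (filter P (List.product [0..<m] (List.product [0..<m] [0..<m]))) \<le> m * (m * m)" for P
    by (rule order_trans[OF length_filter_le]) simp
  ultimately show ?thesis by (simp add: gate_list_def add_mono)
qed

section \<open>Descriptions on the tape and the space a machine can reach\<close>

lemma encode_gate_nonempty: "0 < length (encode_gate g)"
  by (cases g) (auto simp: encode_gate_def)

lemma sym_of_bit_eq_iff [simp]: "sym_of_bit a = sym_of_bit b \<longleftrightarrow> a = b"
  by (auto simp: sym_of_bit_def)

lemma sym_of_bit_neq_0 [simp]: "sym_of_bit a \<noteq> 0" "0 \<noteq> sym_of_bit a"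
  by (auto simp: sym_of_bit_def)

text \<open>The head moves by at most one cell per step, and a cell can only lose its blank while
  the head is on it.\<close>

lemma tm_reachable:
  "(tm_step M ^^ t) (tm_init w) = (q, h, tape) \<Longrightarrow> h \<le> t \<and> (\<forall>i \<ge> length w + t. tape i = 0)"
proof (induction t arbitrary: q h tape)
  case 0
  then show ?case by (auto simp: tm_init_def)
next
  case (Suc t)
  obtain q' h' tape' where c: "(tm_step M ^^ t) (tm_init w) = (q', h', tape')"
    by (metis prod.collapse)
  have "move_head d i \<le> Suc i" for d i by (cases d) auto
  then have "move_head d h' \<le> Suc t" for d
    using Suc.IH[OF c] by (meson le_trans Suc_le_mono)
  then show ?case using Suc.IH[OF c] Suc.prems
    by (auto simp: c split: if_splits prod.splits)
qed

lemma tm_output_length: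
  assumes "tm_halted_with ((tm_step M ^^ t) (tm_init w)) v"
  shows "length v \<le> length w + t"
proof (rule ccontr)
  assume long: "\<not> ?thesis"
  obtain q h tape where c: "(tm_step M ^^ t) (tm_init w) = (q, h, tape)" by (metis prod.collapse)
  have "tape (length w + t) = sym_of_bit (v ! (length w + t))"
    using assms long by (simp add: c tm_halted_with_def)
  then show False using tm_reachable[OF c] by simp
qed

text \<open>
  \<open>Act t i q a\<close>, \<open>State t i q\<close> and \<open>Cell t i a\<close> describe the machine at time \<open>t\<close> with the head on
  cell \<open>i\<close>, in state \<open>q\<close>, reading \<open>a\<close>.  \<open>Start p\<close> says that the description of a gate starts (or the
  output ends) at cell \<open>p\<close>, and \<open>Match p g j\<close> says moreover that the following \<open>j\<close> cells
  agree with the description of \<open>g\<close>.  Two constant wires are needed since the controls of a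
  Toffoli gate are distinct.
\<close>

datatype wire =
    One | One' | Input nat
  | Act nat nat nat nat | State nat nat nat | Cell nat nat nat
  | Start nat | Match nat gate nat

locale description_machine =
  fixes M :: turing_machine and G :: "bool list \<Rightarrow> circuit" and n T m :: nat
  assumes wf: "wf_tm M"
    and halt: "length w = n \<Longrightarrow>
      tm_halted_with ((tm_step M ^^ T) (tm_init w)) (encode_circuit (G w))"
    and valid: "length w = n \<Longrightarrow> valid_circuit (G w)"
    and width: "length w = n \<Longrightarrow> width (G w) = m"
begin

text \<open>The number of tracked cells. Those from \<open>n + T\<close> onwards are blank up to
  time \<open>T\<close>; keeping one of them makes the blank that ends the output visible.\<close>

definition K :: nat where "K = n + T + 1"

abbreviation "Q \<equiv> num_states M"
abbreviation "S \<equiv> num_syms M"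

definition cfg :: "bool list \<Rightarrow> nat \<Rightarrow> tm_config" where
  "cfg w t = (tm_step M ^^ t) (tm_init w)"

abbreviation "state w t \<equiv> fst (cfg w t)"
abbreviation "head w t \<equiv> fst (snd (cfg w t))"
abbreviation "tape w t \<equiv> snd (snd (cfg w t))"

text \<open>Together with \<open>written\<close> and \<open>next_head\<close>, this splits
  \<open>tm_step\<close> into local rules that include the halting convention, so that tableau rows
  after halting repeat.\<close>

definition next_state :: "nat \<Rightarrow> nat \<Rightarrow> nat" where
  "next_state q a = (if q = 1 then q else fst (delta M q a))"

definition written :: "nat \<Rightarrow> nat \<Rightarrow> nat" where
  "written q a = (if q = 1 then a else fst (snd (delta M q a)))"

definition next_head :: "nat \<Rightarrow> nat \<Rightarrow> nat \<Rightarrow> nat" where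
  "next_head i q a = (if q = 1 then i else move_head (snd (snd (delta M q a))) i)"

lemma cfg_Suc:
  "state w (Suc t) = next_state (state w t) (tape w t (head w t))"
  "head w (Suc t) = next_head (head w t) (state w t) (tape w t (head w t))"
  "tape w (Suc t) = (tape w t)(head w t := written (state w t) (tape w t (head w t)))"
proof -
  obtain q h tp where c: "cfg w t = (q, h, tp)" by (metis prod.collapse)
  have "cfg w (Suc t) = tm_step M (q, h, tp)" using c by (simp add: cfg_def)
  then show "state w (Suc t) = next_state (state w t) (tape w t (head w t))"
    "head w (Suc t) = next_head (head w t) (state w t) (tape w t (head w t))"
    "tape w (Suc t) = (tape w t)(head w t := written (state w t) (tape w t (head w t)))"
    by (auto simp: c next_state_def next_head_def written_def split: prod.splits)
qed

lemma cfg_0: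
  "state w 0 = 0" "head w 0 = 0"
  "tape w 0 = (\<lambda>i. if i < length w then sym_of_bit (w ! i) else 0)"
  by (simp_all add: cfg_def tm_init_def)

lemma head_le: "head w t \<le> t"
  using tm_reachable[where M = M and t = t and w = w] by (simp add: cfg_def) (metis prod.collapse)

lemma wf_cfg: "state w t < Q \<and> (\<forall>i. tape w t i < S)"
proof (induction t)
  case 0
  show ?case using wf by (auto simp: cfg_0 wf_tm_def sym_of_bit_def)
next
  case (Suc t)
  have "fst (delta M (state w t) (tape w t (head w t))) < Q \<and>
      fst (snd (delta M (state w t) (tape w t (head w t)))) < S"
    using wf Suc unfolding wf_tm_def by (auto simp: case_prod_unfold)
  then show ?case unfolding cfg_Suc using Suc by (auto simp: next_state_def written_def)
qed

definition desc :: "bool list \<Rightarrow> bool list" where "desc w = encode_circuit (G w)"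

text \<open>The cell right after the gates \<open>us\<close>. The unary width with its terminator
  fills the initial \<open>Suc m\<close> cells.\<close>

definition start :: "gate list \<Rightarrow> nat" where
  "start us = Suc m + length (concat (map encode_gate us))"

lemma tape_desc:
  assumes "length w = n"
  shows "i < length (desc w) \<Longrightarrow> tape w T i = sym_of_bit (desc w ! i)"
    and "tape w T (length (desc w)) = 0"
  using halt[OF assms] by (auto simp: cfg_def desc_def tm_halted_with_def split: prod.splits)

lemma desc_split:
  assumes "length w = n" "gates (G w) = us @ vs"
  shows "take (start us) (desc w) @ concat (map encode_gate vs) = desc w"
    and "start us + length (concat (map encode_gate vs)) = length (desc w)"
  using assms(2) width[OF assms(1)]
  by (auto simp: desc_def start_def encode_circuit_def encode_nat_def)

lemma length_desc: "length w = n \<Longrightarrow> length (desc w) < K"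
  using tm_output_length[OF halt, of w] by (simp add: desc_def K_def)

lemma start_append: "start (us @ vs) = start us + length (concat (map encode_gate vs))"
  by (simp add: start_def)

text \<open>Gate descriptions are nonempty, so \<open>start\<close> strictly increases along the
  prefixes of a gate list.\<close>

lemma start_inject:
  assumes "us @ vs = us' @ vs'" "start us = start us'"
  shows "us = us' \<and> vs = vs'"
proof -
  have *: "ws = []" if "start (us @ ws) = start us" for us ws
    using that encode_gate_nonempty by (cases ws) (auto simp: start_append)
  consider ws where "us' = us @ ws" | ws where "us = us' @ ws"
    using assms(1) by (auto simp: append_eq_append_conv2)
  then have "us = us'" using assms(2) by cases (auto dest: * *[OF sym])
  then show ?thesis using assms(1) by simp
qed

section \<open>Wires of the computation tableau and of the parser\<close>

fun wire_val :: "bool list \<Rightarrow> wire \<Rightarrow> bool" where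
  "wire_val w One = True"
| "wire_val w One' = True"
| "wire_val w (Input i) = w ! i"
| "wire_val w (Act t i q a) = (state w t = q \<and> head w t = i \<and> tape w t i = a)"
| "wire_val w (State t i q) = (state w t = q \<and> head w t = i)"
| "wire_val w (Cell t i a) = (tape w t i = a)"
| "wire_val w (Start p) = (\<exists>us vs. gates (G w) = us @ vs \<and> p = start us)"
| "wire_val w (Match p g j) = ((\<exists>us vs. gates (G w) = us @ vs \<and> p = start us) \<and>
     (\<forall>i<j. tape w T (p + i) = sym_of_bit (encode_gate g ! i)))"

text \<open>\<open>One\<close> as second control turns a Toffoli gate into a copy. At time 0 the
  symbol 2 is the input bit and the symbol 1 its negation, written as 1 plus the bit. Later a cell
  wire is its old value, toggled if a write changes whether the cell holds \<open>a\<close>. A gate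
  starts where the header or a complete match ends.\<close>

fun wire_def :: "wire \<Rightarrow> (wire \<times> wire) list" where
  "wire_def (Act t i q a) = [(State t i q, Cell t i a)]"
| "wire_def (State 0 i q) = (if i = 0 \<and> q = 0 then [(One, One')] else [])"
| "wire_def (State (Suc t) i q) = map (\<lambda>(j, p, a). (Act t j p a, One))
     (filter (\<lambda>(j, p, a). next_head j p a = i \<and> next_state p a = q)
       (List.product [0..<K] (List.product [0..<Q] [0..<S])))"
| "wire_def (Cell 0 i a) =
     (if n \<le> i then (if a = 0 then [(One, One')] else [])
      else if a = 2 then [(Input i, One)]
      else if a = 1 then [(One, One'), (Input i, One)] else [])"
| "wire_def (Cell (Suc t) i a) = (Cell t i a, One) # map (\<lambda>(q, b). (Act t i q b, One))
     (filter (\<lambda>(q, b). (a = b) \<noteq> (a = written q b)) (List.product [0..<Q] [0..<S]))"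
| "wire_def (Start p) = (if p = Suc m then [(One, One')] else []) @
     map (\<lambda>(p', g). (Match p' g (length (encode_gate g)), One))
       (filter (\<lambda>(p', g). p' + length (encode_gate g) = p) (List.product [0..<K] (gate_list m)))"
| "wire_def (Match p g 0) = [(Start p, One)]"
| "wire_def (Match p g (Suc j)) =
     [(Match p g j, Cell T (p + j) (sym_of_bit (encode_gate g ! j)))]"
| "wire_def _ = []"

definition wires :: "wire set" where
  "wires =
     (\<lambda>(t, i, q, a). Act t i q a) ` ({..<T} \<times> {..<K} \<times> {..<Q} \<times> {..<S}) \<union>
     (\<lambda>(t, i, q). State t i q) ` ({..T} \<times> {..<K} \<times> {..<Q}) \<union>
     (\<lambda>(t, i, a). Cell t i a) ` ({..T} \<times> {..<K} \<times> {..<S}) \<union>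
     Start ` {..<K} \<union>
     (\<lambda>(p, g, j). Match p g j) `
       {(p, g, j). g \<in> set (gate_list m) \<and> j \<le> length (encode_gate g) \<and> p + j < K}"

definition inputs :: "wire set" where "inputs = {One, One'} \<union> Input ` {..<n}"

text \<open>The tableau lies at depths up to \<open>2 * T\<close>. Above it every tape position has
  three levels: matches of at least one cell that end there, \<open>Start\<close>, and empty matches
  that begin there.\<close>

fun depth :: "wire \<Rightarrow> nat" where
  "depth (Act t i q a) = 2 * t + 1"
| "depth (State t i q) = 2 * t"
| "depth (Cell t i a) = 2 * t"
| "depth (Start p) = 2 * T + 1 + 3 * p"
| "depth (Match p g 0) = 2 * T + 2 + 3 * p"
| "depth (Match p g (Suc j)) = 2 * T + 3 + 3 * (p + j)"
| "depth _ = 0"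

lemma in_wires [simp]:
  "Act t i q a \<in> wires \<longleftrightarrow> t < T \<and> i < K \<and> q < Q \<and> a < S"
  "State t i q \<in> wires \<longleftrightarrow> t \<le> T \<and> i < K \<and> q < Q"
  "Cell t i a \<in> wires \<longleftrightarrow> t \<le> T \<and> i < K \<and> a < S"
  "Start p \<in> wires \<longleftrightarrow> p < K"
  "Match p g j \<in> wires \<longleftrightarrow> valid_gate m g \<and> j \<le> length (encode_gate g) \<and> p + j < K"
  "One \<notin> wires" "One' \<notin> wires" "Input i \<notin> wires"
  by (auto simp: wires_def set_gate_list image_iff)

lemma wire_cases [consumes 1, case_names Act State Cell Start Match]:
  assumes "l \<in> wires"
  obtains t i q a where "l = Act t i q a" "t < T" "i < K" "q < Q" "a < S"
  | t i q where "l = State t i q" "t \<le> T" "i < K" "q < Q"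
  | t i a where "l = Cell t i a" "t \<le> T" "i < K" "a < S"
  | p where "l = Start p" "p < K"
  | p g j where "l = Match p g j" "valid_gate m g" "j \<le> length (encode_gate g)" "p + j < K"
  using assms by (cases l) auto

lemma finite_wires: "finite wires"
proof -
  have "{(p, g, j). g \<in> set (gate_list m) \<and> j \<le> length (encode_gate g) \<and> p + j < K} \<subseteq>
      {..<K} \<times> set (gate_list m) \<times> {..<K}" by auto
  from finite_subset[OF this] show ?thesis unfolding wires_def by simp
qed

text \<open>This makes the definitions acyclic and the Toffoli gates valid: their controls differ,
  and time in the tableau, respectively the tape position in the parser, orders the
  dependencies.\<close>

lemma wire_def_controls:
  assumes "l \<in> wires" "(a, b) \<in> set (wire_def l)"
  shows "a \<noteq> b \<and> (a \<in> inputs \<or> a \<in> wires \<and> depth a < depth l) \<and>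
    (b \<in> inputs \<or> b \<in> wires \<and> depth b < depth l)"
  using assms(1)
proof (cases rule: wire_cases)
  case (Act t i q a)
  then show ?thesis using assms(2) by auto
next
  case (State t i q)
  then show ?thesis using assms(2) by (cases t) (auto simp: inputs_def split: if_splits)
next
  case (Cell t i a)
  then show ?thesis using assms(2) by (cases t) (auto simp: inputs_def split: if_splits)
next
  case (Start p)
  \<comment> \<open>Descriptions are nonempty, so a full match has the \<open>Suc\<close> form of
    \<open>depth\<close>, one level below the \<open>Start\<close> at its end.\<close>
  have "depth (Match p' g (length (encode_gate g))) < depth (Start (p' + length (encode_gate g)))" for p' g
    using encode_gate_nonempty[of g] by (cases "length (encode_gate g)") auto
  then show ?thesis using assms(2) Start
    by (auto simp: inputs_def set_gate_list simp del: depth.simps split: if_splits)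
next
  case (Match p g j)
  have "sym_of_bit c < S" for c using wf by (auto simp: wf_tm_def sym_of_bit_def)
  then show ?thesis using assms(2) Match by (cases j; cases "j - 1") (auto simp: inputs_def)
qed

text \<open>A match only compares symbols. It identifies the next gate because gate descriptions can
  be decoded from the front without ambiguity.\<close>

lemma wire_val_Match_full:
  assumes w: "length w = n"
  shows "wire_val w (Match p g (length (encode_gate g))) \<longleftrightarrow>
    (\<exists>us vs. gates (G w) = us @ g # vs \<and> p = start us)"
proof
  assume *: "wire_val w (Match p g (length (encode_gate g)))"
  then obtain us vs where g: "gates (G w) = us @ vs" and p: "p = start us" by auto
  let ?e = "concat (map encode_gate vs)"
  have len: "p + length ?e = length (desc w)" using desc_split(2)[OF w g] p by simp
  have tape: "tape w T (p + i) = sym_of_bit (encode_gate g ! i)" if "i < length (encode_gate g)" for i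
    using * that by simp
  \<comment> \<open>A match cannot run past the output: the cell there is blank, and no bit is
    encoded by the blank.\<close>
  have le: "length (encode_gate g) \<le> length ?e"
  proof (rule ccontr)
    assume "\<not> ?thesis"
    with tape[of "length ?e"] tape_desc(2)[OF w] len show False by simp
  qed
  have e: "desc w ! (p + i) = ?e ! i" if "i < length ?e" for i
  proof -
    have "desc w ! (p + i) = (take p (desc w) @ ?e) ! (p + i)" using desc_split(1)[OF w g] p by simp
    then show ?thesis using len that by (simp add: nth_append)
  qed
  have "take (length (encode_gate g)) ?e = encode_gate g"
  proof (rule nth_equalityI)
    fix i assume i: "i < length (take (length (encode_gate g)) ?e)"
    then show "take (length (encode_gate g)) ?e ! i = encode_gate g ! i"
      using tape[of i] tape_desc(1)[OF w, of "p + i"] e[of i] len by simp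
  qed (use le in simp)
  then have "encode_gate g @ drop (length (encode_gate g)) ?e = ?e"
    by (metis append_take_drop_id)
  moreover obtain h vs' where "vs = h # vs'"
    using le encode_gate_nonempty[of g] by (cases vs) auto
  ultimately have "vs = g # vs'" by (simp add: encode_gate_append_inject)
  with g p show "\<exists>us vs. gates (G w) = us @ g # vs \<and> p = start us" by blast
next
  assume "\<exists>us vs. gates (G w) = us @ g # vs \<and> p = start us"
  then obtain us vs where g: "gates (G w) = us @ g # vs" and p: "p = start us" by blast
  have "tape w T (p + i) = sym_of_bit (encode_gate g ! i)" if "i < length (encode_gate g)" for i
  proof -
    have len: "p + length (concat (map encode_gate (g # vs))) = length (desc w)"
      using desc_split(2)[OF w g] p by simp
    have "desc w ! (p + i) = (take p (desc w) @ concat (map encode_gate (g # vs))) ! (p + i)"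
      using desc_split(1)[OF w g] p by simp
    also have "\<dots> = encode_gate g ! i" using len that by (simp add: nth_append)
    finally show ?thesis using tape_desc(1)[OF w, of "p + i"] len that by simp
  qed
  with g p show "wire_val w (Match p g (length (encode_gate g)))" by auto
qed

lemma valid_gates: "length w = n \<Longrightarrow> gates (G w) = us @ g # vs \<Longrightarrow> valid_gate m g"
  using valid[of w] width[of w] by (auto simp: valid_circuit_iff)

lemma start_less_K:
  assumes "length w = n" "gates (G w) = us @ vs"
  shows "start us < K"
  using desc_split(2)[OF assms] length_desc[OF assms(1)] by simp

text \<open>The local equations required by \<open>bit_prog_gates\<close>. In each exclusive or, at
  most one of the alternatives from a case distinction is true.\<close>

lemma wire_val_def:
  assumes w: "length w = n" and l: "l \<in> wires"
  shows "wire_val w l \<longleftrightarrow>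
    odd (length (filter (\<lambda>(a, b). wire_val w a \<and> wire_val w b) (wire_def l)))"
  using l
proof (cases rule: wire_cases)
  case (Act t i q a)
  then show ?thesis by simp
next
  case (State t i q)
  show ?thesis
  proof (cases t)
    case 0
    with State show ?thesis by (auto simp: cfg_0)
  next
    case (Suc t')
    \<comment> \<open>Only the actual head position, state and symbol at time \<open>t'\<close> can
      contribute, and \<open>head_le\<close> places them among the tracked cells.\<close>
    let ?P = "\<lambda>(j, p, a). (next_head j p a = i \<and> next_state p a = q) \<and>
      state w t' = p \<and> head w t' = j \<and> tape w t' j = a"
    let ?L = "List.product [0..<K] (List.product [0..<Q] [0..<S])"
    have "odd (length (filter ?P ?L)) \<longleftrightarrow> (\<exists>x \<in> set ?L. ?P x)"
      by (rule odd_length_filter_unique) (auto simp: distinct_product)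
    also have "\<dots> \<longleftrightarrow> wire_val w l"
    proof -
      have "head w t' < K" using head_le[of w t'] State Suc by (simp add: K_def)
      then show ?thesis using wf_cfg[of w t'] by (auto simp: State Suc cfg_Suc)
    qed
    finally show ?thesis
      by (simp add: State Suc filter_map comp_def case_prod_unfold conj_ac)
  qed
next
  case (Cell t i a)
  show ?thesis
  proof (cases t)
    case 0
    with Cell w show ?thesis by (auto simp: cfg_0 sym_of_bit_def)
  next
    case (Suc t')
    \<comment> \<open>The wire toggles exactly if the head is on cell \<open>i\<close> and exactly
      one of the old and the new symbol is \<open>a\<close>.\<close>
    let ?P = "\<lambda>(q, b). ((a = b) \<noteq> (a = written q b)) \<and>
      state w t' = q \<and> head w t' = i \<and> tape w t' i = b"
    let ?L = "List.product [0..<Q] [0..<S]"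
    have "odd (length (filter ?P ?L)) \<longleftrightarrow> (\<exists>x \<in> set ?L. ?P x)"
      by (rule odd_length_filter_unique) (auto simp: distinct_product)
    also have "\<dots> \<longleftrightarrow> wire_val w l \<noteq> (tape w t' i = a)"
      using wf_cfg[of w t'] by (auto simp: Cell Suc cfg_Suc)
    finally have "odd (length (filter ?P ?L)) \<longleftrightarrow> wire_val w l \<noteq> (tape w t' i = a)" .
    moreover have "length (filter (\<lambda>(a, b). wire_val w a \<and> wire_val w b) (wire_def l)) =
        of_bool (tape w t' i = a) + length (filter ?P ?L)"
      by (simp add: Cell Suc filter_map comp_def case_prod_unfold conj_ac split del: if_split)
    ultimately show ?thesis by (cases "tape w t' i = a") simp_all
  qed
next
  case (Start p)
  let ?P = "\<lambda>(p', g). p' + length (encode_gate g) = p \<and>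
    wire_val w (Match p' g (length (encode_gate g)))"
  let ?L = "List.product [0..<K] (gate_list m)"
  have "odd (length (filter ?P ?L)) \<longleftrightarrow> (\<exists>x \<in> set ?L. ?P x)"
  proof (rule odd_length_filter_unique)
    have *: "\<exists>us g vs. x = (start us, g) \<and> gates (G w) = us @ g # vs \<and>
        start us + length (encode_gate g) = p" if "?P x" for x
      using that unfolding wire_val_Match_full[OF w] by auto
    fix x y assume "?P x" "?P y"
    from *[OF this(1)] *[OF this(2)] obtain us g vs us' g' vs' where
      x: "x = (start us, g)" "gates (G w) = us @ g # vs" and
      y: "y = (start us', g')" "gates (G w) = us' @ g' # vs'" and
      p: "start us + length (encode_gate g) = p" "start us' + length (encode_gate g') = p"
      by blast
    \<comment> \<open>Two gates ending at the same cell would be the last gates of two prefixes with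
      equal \<open>start\<close>.\<close>
    have "us @ [g] = us' @ [g'] \<and> vs = vs'"
      by (rule start_inject) (use x y p in \<open>auto simp: start_append\<close>)
    with x y show "x = y" by simp
  qed (simp add: distinct_product distinct_gate_list)
  also have "\<dots> \<longleftrightarrow> (\<exists>us g vs. gates (G w) = us @ g # vs \<and> p = start (us @ [g]))"
  proof
    assume "\<exists>x \<in> set ?L. ?P x"
    then obtain p' g where "p' + length (encode_gate g) = p"
      "wire_val w (Match p' g (length (encode_gate g)))" by auto
    then show "\<exists>us g vs. gates (G w) = us @ g # vs \<and> p = start (us @ [g])"
      unfolding wire_val_Match_full[OF w] by (force simp: start_append)
  next
    assume "\<exists>us g vs. gates (G w) = us @ g # vs \<and> p = start (us @ [g])"
    then obtain us g vs where g: "gates (G w) = us @ g # vs" "p = start (us @ [g])" by blast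
    then have "wire_val w (Match (start us) g (length (encode_gate g)))"
      unfolding wire_val_Match_full[OF w] by blast
    then have "?P (start us, g)" using g by (simp add: start_append del: wire_val.simps)
    moreover have "(start us, g) \<in> set ?L"
      using start_less_K[OF w g(1)] valid_gates[OF w g(1)] by (simp add: set_gate_list)
    ultimately show "\<exists>x \<in> set ?L. ?P x" by blast
  qed
  finally have odd: "odd (length (filter ?P ?L)) \<longleftrightarrow>
    (\<exists>us g vs. gates (G w) = us @ g # vs \<and> p = start (us @ [g]))" .
  have "wire_val w l \<longleftrightarrow> (p = Suc m) \<noteq> odd (length (filter ?P ?L))"
  proof -
    \<comment> \<open>No gate ends where the header ends, so the exclusive or of the two cases is a
      disjunction.\<close>
    have "p \<noteq> Suc m" if parity: "odd (length (filter ?P ?L))"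
    proof -
      obtain us g where "p = start (us @ [g])" using parity odd by blast
      then show ?thesis using encode_gate_nonempty[of g] by (simp add: start_def)
    qed
    moreover have "wire_val w l \<longleftrightarrow> p = Suc m \<or> odd (length (filter ?P ?L))"
    proof -
      have "(\<exists>us vs. gates (G w) = us @ vs \<and> p = start us) \<longleftrightarrow>
          p = start [] \<or> (\<exists>us g vs. gates (G w) = us @ g # vs \<and> p = start (us @ [g]))"
        (is "?l \<longleftrightarrow> ?r")
      proof
        assume ?l
        then obtain us vs where us: "gates (G w) = us @ vs" "p = start us" by blast
        then show ?r by (cases us rule: rev_cases) auto
      next
        assume ?r
        then show ?l
        proof (elim disjE exE conjE)
          assume "p = start []"
          then show ?l by (intro exI[of _ "[]"] exI[of _ "gates (G w)"]) simp
        next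
          fix us g vs assume "gates (G w) = us @ g # vs" "p = start (us @ [g])"
          then show ?l by (intro exI[of _ "us @ [g]"] exI[of _ vs]) simp
        qed
      qed
      moreover have "start [] = Suc m" by (simp add: start_def)
      ultimately show ?thesis unfolding odd by (simp add: Start)
    qed
    ultimately show ?thesis by blast
  qed
  moreover have "length (filter (\<lambda>(a, b). wire_val w a \<and> wire_val w b) (wire_def l)) =
      of_bool (p = Suc m) + length (filter ?P ?L)"
  proof -
    have "filter ((\<lambda>(a, b). wire_val w a \<and> wire_val w b) \<circ> (\<lambda>(p', g). (Match p' g (length (encode_gate g)), One)))
        (filter (\<lambda>(p', g). p' + length (encode_gate g) = p) ?L) = filter ?P ?L"
      unfolding filter_filter by (rule filter_cong) (auto simp del: wire_val.simps(8))
    then show ?thesis by (simp add: Start filter_map del: wire_val.simps(8) filter_filter)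
  qed
  ultimately show ?thesis by (cases "p = Suc m") simp_all
next
  case (Match p g j)
  then show ?thesis by (cases j) (auto simp: less_Suc_eq)
qed

end

section \<open>Extracting the gate list and bounding its size\<close>

lemma filter_eq_singleton: "distinct xs \<Longrightarrow> x \<in> set xs \<Longrightarrow> filter (\<lambda>y. y = x) xs = [x]"
  by (induction xs) (auto simp: filter_empty_conv)

lemma upt_split: "i \<le> j \<Longrightarrow> j \<le> k \<Longrightarrow> [i..<k] = [i..<j] @ [j..<k]"
  using upt_add_eq_append[of i j "k - j"] by simp

context description_machine
begin

text \<open>All conceivable occurrences of gates, sorted by position: whichever of them are real
  then appear in the order of the circuit.\<close>

definition emitted :: "(nat \<times> gate) list" where
  "emitted = concat (map (\<lambda>p. map (Pair p)
     (filter (\<lambda>g. p + length (encode_gate g) < K) (gate_list m))) [0..<K])"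

lemma gates_at:
  assumes w: "length w = n"
  defines "E \<equiv> \<lambda>p. filter (\<lambda>g. p + length (encode_gate g) < K \<and>
      wire_val w (Match p g (length (encode_gate g)))) (gate_list m)"
  assumes "gates (G w) = us @ vs"
  shows "concat (map E [start us..<K]) = vs"
  using assms(3)
proof (induction vs arbitrary: us)
  case Nil
  have "E p = []" if "start us \<le> p" for p
  proof -
    have False if "gates (G w) = us' @ g # vs'" "p = start us'" for us' g vs'
    proof -
      have "us = us' @ g # vs'" using that Nil by simp
      then show False
        using \<open>start us \<le> p\<close> \<open>p = start us'\<close> encode_gate_nonempty[of g] by (simp add: start_append)
    qed
    then show ?thesis
      unfolding E_def wire_val_Match_full[OF w] by (auto simp: filter_empty_conv)
  qed
  then show ?case by (auto simp: concat_eq_Nil_conv)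
next
  case (Cons g vs)
  let ?s = "start us" and ?s' = "start (us @ [g])"
  have less: "?s < ?s'" "?s' < K"
    using encode_gate_nonempty[of g] start_less_K[OF w, of "us @ [g]" vs] Cons.prems
    by (auto simp: start_append)
  have here: "E ?s = [g]"
  proof -
    have "?s + length (encode_gate h) < K \<and>
        wire_val w (Match ?s h (length (encode_gate h))) \<longleftrightarrow> h = g" for h
      unfolding wire_val_Match_full[OF w]
      using less Cons.prems by (auto simp: start_append dest: start_inject[OF trans[OF sym]])
    then have "E ?s = filter (\<lambda>h. h = g) (gate_list m)" unfolding E_def by simp
    moreover have "g \<in> set (gate_list m)"
      using valid_gates[OF w Cons.prems] by (simp add: set_gate_list)
    ultimately show ?thesis by (simp add: filter_eq_singleton distinct_gate_list)
  qed
  \<comment> \<open>Any other prefix of the gate list either stops no later than \<open>us\<close>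
    or contains \<open>us\<close> and \<open>g\<close>, so no gate starts strictly inside
    \<open>g\<close>.\<close>
  have between: "E p = []" if "?s < p" "p < ?s'" for p
  proof -
    have False if "gates (G w) = us' @ h # vs'" "p = start us'" for us' h vs'
    proof -
      have "us' @ h # vs' = us @ g # vs" using that Cons.prems by simp
      then consider "us' = us" | ws where "us' = us @ g # ws" | ws where "us = us' @ h # ws"
        by (auto simp: append_eq_append_conv2 Cons_eq_append_conv append_eq_Cons_conv)
      then show False
        using \<open>?s < p\<close> \<open>p < ?s'\<close> \<open>p = start us'\<close> by cases (auto simp: start_append)
    qed
    then show ?thesis
      unfolding E_def wire_val_Match_full[OF w] by (auto simp: filter_empty_conv)
  qed
  have "[?s..<K] = ?s # [Suc ?s..<?s'] @ [?s'..<K]"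
    using less upt_split[of "Suc ?s" ?s' K] by (simp add: upt_conv_Cons)
  moreover have "concat (map E [Suc ?s..<?s']) = []"
    using between by (auto simp: concat_eq_Nil_conv)
  moreover have "concat (map E [?s'..<K]) = vs"
    using Cons.IH[of "us @ [g]"] Cons.prems by simp
  ultimately show ?case by (simp add: here)
qed

lemma filter_emitted:
  assumes w: "length w = n"
  shows "map snd (filter (\<lambda>(p, g). wire_val w (Match p g (length (encode_gate g)))) emitted) =
    gates (G w)"
proof -
  let ?E = "\<lambda>p. filter (\<lambda>g. p + length (encode_gate g) < K \<and>
      wire_val w (Match p g (length (encode_gate g)))) (gate_list m)"
  have "map snd (filter (\<lambda>(p, g). wire_val w (Match p g (length (encode_gate g)))) emitted) =
      concat (map ?E [0..<K])"
    unfolding emitted_def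
    by (simp add: filter_concat map_concat comp_def filter_map conj_commute del: wire_val.simps)
  also have "\<dots> = concat (map ?E [start []..<K])"
  proof -
    have sK: "start [] \<le> K"
      using start_less_K[OF w, of "[]"] by simp
    have "?E p = []" if "p < start []" for p
      unfolding wire_val_Match_full[OF w] using that
      by (auto simp: filter_empty_conv start_def)
    then have "concat (map ?E [0..<start []]) = []"
      by (simp add: concat_eq_Nil_conv del: wire_val.simps)
    then show ?thesis
      using upt_split[of 0 "start []" K] sK by (simp del: wire_val.simps)
  qed
  also have "\<dots> = gates (G w)" using gates_at[OF w, of "[]"] by simp
  finally show ?thesis .
qed

lemma emitted_wires:
  assumes "(p, g) \<in> set emitted"
  shows "valid_gate m g" "Match p g (length (encode_gate g)) \<in> wires"
  using assms by (auto simp: emitted_def set_gate_list)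

lemma length_wire_def:
  "length (wire_def l) \<le> K * (Q * S) + K * length (gate_list m) + Q * S + 2"
proof -
  have "length (filter P (List.product [0..<K] (List.product [0..<Q] [0..<S]))) \<le> K * (Q * S)" for P
    by (rule order_trans[OF length_filter_le]) simp
  moreover have "length (filter P (List.product [0..<Q] [0..<S])) \<le> Q * S" for P
    by (rule order_trans[OF length_filter_le]) simp
  moreover have "length (filter P (List.product [0..<K] (gate_list m))) \<le> K * length (gate_list m)" for P
    by (rule order_trans[OF length_filter_le]) simp
  ultimately show ?thesis
    by (cases l rule: wire_def.cases) (simp_all add: trans_le_add1 trans_le_add2 le_SucI)
qed

lemma card_wires:
  "card wires \<le> T * (K * (Q * S)) + Suc T * (K * Q) + Suc T * (K * S) + K +
    K * (length (gate_list m) * K)"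
proof -
  let ?A = "{(p, g, j). g \<in> set (gate_list m) \<and> j \<le> length (encode_gate g) \<and> p + j < K}"
  have sub: "?A \<subseteq> {..<K} \<times> set (gate_list m) \<times> {..<K}" by auto
  then have "finite ?A" by (rule finite_subset) simp
  have "card ?A \<le> K * (length (gate_list m) * K)"
    using card_mono[OF _ sub] by (simp add: distinct_card[OF distinct_gate_list])
  then have "card ((\<lambda>(p, g, j). Match p g j) ` ?A) \<le> K * (length (gate_list m) * K)"
    using card_image_le[OF \<open>finite ?A\<close>] le_trans by blast
  moreover have "card ((\<lambda>(t, i, q, a). Act t i q a) ` ({..<T} \<times> {..<K} \<times> {..<Q} \<times> {..<S}))
      \<le> T * (K * (Q * S))"
    by (rule order_trans[OF card_image_le]) simp_all
  moreover have "card ((\<lambda>(t, i, q). State t i q) ` ({..T} \<times> {..<K} \<times> {..<Q})) \<le> Suc T * (K * Q)"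
    by (rule order_trans[OF card_image_le]) simp_all
  moreover have "card ((\<lambda>(t, i, a). Cell t i a) ` ({..T} \<times> {..<K} \<times> {..<S})) \<le> Suc T * (K * S)"
    by (rule order_trans[OF card_image_le]) simp_all
  moreover have "card (Start ` {..<K}) \<le> K"
    by (rule order_trans[OF card_image_le]) simp_all
  ultimately show ?thesis
    unfolding wires_def by (intro order_trans[OF card_Un_le] add_mono)
qed

text \<open>The string is read at offset \<open>o'\<close>, the constants sit at \<open>Z\<close>
  and \<open>Suc Z\<close>, and the wires above them must start at 0. Both lists are fixed before
  \<open>w\<close> is: \<open>cs\<close> attaches to each conceivable gate the qubit that decides
  whether it occurs.\<close>

lemma description_circuit:
  assumes "o' + n \<le> Z"
  obtains prog cs where
    "\<forall>g \<in> set prog. classical g \<and> valid_gate (Z + 2 + card wires) g"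
    "length prog \<le> card wires * (K * (Q * S) + K * length (gate_list m) + Q * S + 2)"
    "\<forall>(c, g) \<in> set cs. valid_gate m g \<and> c < Z + 2 + card wires"
    "length cs \<le> K * length (gate_list m)"
    "\<And>x w. length w = n \<Longrightarrow> (\<And>i. i < n \<Longrightarrow> bit x (o' + i) \<longleftrightarrow> w ! i) \<Longrightarrow>
       bit x Z \<Longrightarrow> bit x (Suc Z) \<Longrightarrow> (\<And>i. Z + 2 \<le> i \<Longrightarrow> \<not> bit x i) \<Longrightarrow>
       (\<forall>i. i < Z + 2 \<or> Z + 2 + card wires \<le> i \<longrightarrow> bit (fold gate_perm prog x) i = bit x i) \<and>
       map snd (filter (\<lambda>(c, g). bit (fold gate_perm prog x) c) cs) = rev (gates (G w))"
proof -
  obtain ls where ls: "set ls = wires" "distinct ls" "sorted (map depth ls)"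
    using obtain_sorted_list[OF finite_wires] .
  have len: "length ls = card wires" using ls by (metis distinct_card)
  \<comment> \<open>Wires are numbered by their rank in the topological order, right above the two
    constants; inputs keep their given places.\<close>
  define pos where "pos l = (case l of One \<Rightarrow> Z | One' \<Rightarrow> Suc Z | Input i \<Rightarrow> o' + i
    | _ \<Rightarrow> Z + 2 + (THE i. i < length ls \<and> ls ! i = l))" for l
  have pos_nth: "pos (ls ! i) = Z + 2 + i" if "i < length ls" for i
  proof -
    have "ls ! i \<in> wires" using that ls(1) nth_mem by blast
    moreover have "(THE j. j < length ls \<and> ls ! j = ls ! i) = i"
      using that ls(2) by (auto simp: nth_eq_iff_index_eq)
    ultimately show ?thesis by (cases rule: wire_cases) (simp_all add: pos_def)
  qed
  have pos_wires: "Z + 2 \<le> pos l \<and> pos l < Z + 2 + card wires" if l: "l \<in> wires" for l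
  proof -
    obtain i where "i < length ls" "ls ! i = l"
      using l unfolding ls(1)[symmetric] in_set_conv_nth by blast
    then show ?thesis using pos_nth[of i] len by simp
  qed
  have pos_inputs: "pos l < Z + 2" if "l \<in> inputs" for l
    using that assms by (auto simp: inputs_def pos_def)
  have "inj_on pos (set ls)"
    unfolding inj_on_def using pos_nth by (auto simp: in_set_conv_nth)
  moreover have "inj_on pos inputs"
    using assms by (auto simp: inj_on_def inputs_def pos_def)
  moreover have "pos a \<noteq> pos b" if "a \<in> inputs" "b \<in> set ls" for a b
    using pos_inputs[OF that(1)] pos_wires[of b] that(2) ls(1) by simp
  then have "pos ` (inputs - set ls) \<inter> pos ` (set ls - inputs) = {}" by blast
  ultimately have inj: "inj_on pos (inputs \<union> set ls)"
    using \<open>inj_on pos (set ls)\<close> by (simp only: inj_on_Un simp_thms)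
  have disj: "inputs \<inter> set ls = {}" by (auto simp: inputs_def ls(1))
  define prog where "prog = prog_gates pos wire_def ls"
  \<comment> \<open>Undoing a circuit takes its gates from last to first, hence
    \<open>rev\<close>.\<close>
  define cs where "cs = rev (map (\<lambda>(p, g). (pos (Match p g (length (encode_gate g))), g)) emitted)"
  show thesis
  proof
    show "\<forall>g \<in> set prog. classical g \<and> valid_gate (Z + 2 + card wires) g"
    proof
      fix g assume "g \<in> set prog"
      then obtain l a b where l: "l \<in> wires" "(a, b) \<in> set (wire_def l)"
        and g: "g = Toffoli (pos a) (pos b) (pos l)"
        by (auto simp: prog_def prog_gates_def ls(1))
      note ctrl = wire_def_controls[OF l]
      have mem: "a \<in> inputs \<union> set ls" "b \<in> inputs \<union> set ls" "l \<in> inputs \<union> set ls"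
        using ctrl l(1) ls(1) by auto
      have "a \<noteq> l" "b \<noteq> l" using ctrl l(1) disj ls(1) by auto
      then have "pos a \<noteq> pos b" "pos a \<noteq> pos l" "pos b \<noteq> pos l"
        using ctrl inj_on_eq_iff[OF inj] mem by simp_all
      moreover have "pos k < Z + 2 + card wires" if "k \<in> inputs \<union> set ls" for k
        using that pos_wires[of k] pos_inputs[of k] ls(1) by auto
      ultimately show "classical g \<and> valid_gate (Z + 2 + card wires) g"
        using mem by (simp add: g valid_gate_def)
    qed
    have "length prog \<le> length ls * (K * (Q * S) + K * length (gate_list m) + Q * S + 2)"
      unfolding prog_def prog_gates_def
    proof (induction ls)
      case (Cons l ls)
      then show ?case using length_wire_def[of l] by simp
    qed simp
    then show "length prog \<le> card wires * (K * (Q * S) + K * length (gate_list m) + Q * S + 2)"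
      by (simp add: len)
    show "\<forall>(c, g) \<in> set cs. valid_gate m g \<and> c < Z + 2 + card wires"
      using emitted_wires pos_wires by (auto simp: cs_def)
    have "length (filter P (gate_list m)) \<le> length (gate_list m)" for P by simp
    then have "length emitted \<le> (\<Sum>p\<leftarrow>[0..<K]. length (gate_list m))"
      unfolding emitted_def by (auto simp: length_concat comp_def intro!: sum_list_mono)
    then show "length cs \<le> K * length (gate_list m)"
      by (simp add: cs_def sum_list_triv)
  next
    fix x :: nat and w
    assume w: "length w = n" and input: "\<And>i. i < n \<Longrightarrow> bit x (o' + i) \<longleftrightarrow> w ! i"
      and one: "bit x Z" "bit x (Suc Z)" and zero: "\<And>i. Z + 2 \<le> i \<Longrightarrow> \<not> bit x i"
    let ?y = "fold gate_perm prog x"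
    have *: "(\<forall>l \<in> inputs \<union> set ls. bit ?y (pos l) \<longleftrightarrow> wire_val w l) \<and>
        (\<forall>i. i \<notin> pos ` set ls \<longrightarrow> bit ?y i = bit x i)"
      unfolding prog_def
    proof (rule bit_prog_gates[OF inj ls(2) disj])
      fix us l vs a b assume split: "ls = us @ l # vs" and ab: "(a, b) \<in> set (wire_def l)"
      have "l \<in> wires" using split ls(1) by auto
      note ctrl = wire_def_controls[OF this ab]
      show "a \<in> inputs \<union> set us \<and> b \<in> inputs \<union> set us"
        using ctrl sorted_rank_prefix[where f = depth and us = us and l = l and vs = vs] ls split by auto
    next
      fix l assume "l \<in> set ls"
      then show "wire_val w l \<longleftrightarrow>
          odd (length (filter (\<lambda>(a, b). wire_val w a \<and> wire_val w b) (wire_def l)))"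
        using wire_val_def[OF w] ls(1) by blast
      show "\<not> bit x (pos l)" using \<open>l \<in> set ls\<close> ls(1) pos_wires zero by auto
    next
      fix a assume "a \<in> inputs"
      then show "bit x (pos a) \<longleftrightarrow> wire_val w a"
        using input one by (auto simp: inputs_def pos_def)
    qed
    have "i \<notin> pos ` set ls" if "i < Z + 2 \<or> Z + 2 + card wires \<le> i" for i
      using that by (auto simp: ls(1) dest!: pos_wires)
    with * have keep: "\<forall>i. i < Z + 2 \<or> Z + 2 + card wires \<le> i \<longrightarrow> bit ?y i = bit x i" by simp
    have "filter (\<lambda>(p, g). bit ?y (pos (Match p g (length (encode_gate g))))) emitted =
        filter (\<lambda>(p, g). wire_val w (Match p g (length (encode_gate g)))) emitted"
      by (rule filter_cong) (use * emitted_wires(2) ls(1) in \<open>auto simp del: wire_val.simps\<close>)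
    then have "map snd (filter (\<lambda>(p, g). bit ?y (pos (Match p g (length (encode_gate g))))) emitted) =
        gates (G w)" using filter_emitted[OF w] by simp
    moreover have "map snd (filter (\<lambda>(c, g). bit ?y c) cs) =
        rev (map snd (filter (\<lambda>(p, g). bit ?y (pos (Match p g (length (encode_gate g))))) emitted))"
      by (simp add: cs_def rev_filter[symmetric] rev_map[symmetric] filter_map comp_def case_prod_unfold)
    ultimately show "(\<forall>i. i < Z + 2 \<or> Z + 2 + card wires \<le> i \<longrightarrow> bit ?y i = bit x i) \<and>
        map snd (filter (\<lambda>(c, g). bit ?y c) cs) = rev (gates (G w))" using keep by simp
  qed
qed

end

section \<open>The distinguisher\<close>

text \<open>\<open>T^4\<close> is the Z gate, and conjugating it by Hadamard gives NOT, which is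
  needed to set the constant wires.\<close>

definition not_gates :: "nat \<Rightarrow> gate list" where
  "not_gates i = [Hadamard i] @ replicate 4 (TGate i) @ [Hadamard i]"

lemma run_not_gates: "run_gates (not_gates i) \<psi> = (\<lambda>x. \<psi> (flip_bit i x))"
proof
  fix x :: nat
  have four: "run_gates (replicate 4 (TGate i)) \<psi> = (\<lambda>x. (if bit x i then - 1 else 1) * \<psi> x)" for \<psi>
  proof -
    have "real 4 * pi / 4 = pi" by simp
    then show ?thesis unfolding run_TGate_power by (simp only: cis_pi)
  qed
  show "run_gates (not_gates i) \<psi> x = \<psi> (flip_bit i x)"
    by (simp only: not_gates_def fold_append comp_apply four)
      (simp add: bit_flip_bit_iff field_simps)
qed

lemma valid_not_gates: "i < w \<Longrightarrow> \<forall>g \<in> set (not_gates i). valid_gate w g"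
  by (auto simp: not_gates_def valid_gate_def)

definition outcome :: "nat \<Rightarrow> nat \<Rightarrow> bool list" where
  "outcome n y = map (bit y) [0..<n]"

lemma finite_bool_lists: "finite {\<sigma> :: bool list. length \<sigma> = n}"
  using finite_lists_length_eq[of "UNIV :: bool set" n] by simp

text \<open>Each basis outcome \<open>y\<close> counts for exactly one string, given by its low
  \<open>n\<close> bits.\<close>

lemma output_prob_sum:
  "(\<Sum>\<sigma> | length \<sigma> = n. output_prob C \<phi> \<sigma> * h \<sigma>) =
    (\<Sum>y<2 ^ width C. (cmod (run_circuit C \<phi> y))\<^sup>2 * h (outcome n y))"
proof -
  have iff: "(\<forall>i < length \<sigma>. bit y i = \<sigma> ! i) \<longleftrightarrow> \<sigma> = outcome n y" if "length \<sigma> = n" for \<sigma> y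
    using that by (auto simp: outcome_def list_eq_iff_nth_eq)
  have "(\<Sum>\<sigma> | length \<sigma> = n. output_prob C \<phi> \<sigma> * h \<sigma>) =
      (\<Sum>\<sigma> | length \<sigma> = n. \<Sum>y<2 ^ width C.
        if outcome n y = \<sigma> then (cmod (run_circuit C \<phi> y))\<^sup>2 * h \<sigma> else 0)"
  proof (rule sum.cong)
    fix \<sigma> :: "bool list" assume "\<sigma> \<in> {\<sigma>. length \<sigma> = n}"
    then have *: "{x. \<forall>i < length \<sigma>. bit x i = \<sigma> ! i} \<inter> {..<2 ^ width C} =
        {y \<in> {..<2 ^ width C}. outcome n y = \<sigma>}"
      using iff[of \<sigma>] by auto
    show "output_prob C \<phi> \<sigma> * h \<sigma> = (\<Sum>y<2 ^ width C.
        if outcome n y = \<sigma> then (cmod (run_circuit C \<phi> y))\<^sup>2 * h \<sigma> else 0)"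
      unfolding output_prob_def outcome_prob_def *
      by (simp add: sum.inter_filter[symmetric] sum_distrib_right)
  qed simp
  also have "\<dots> = (\<Sum>y<2 ^ width C. \<Sum>\<sigma> | length \<sigma> = n.
        if outcome n y = \<sigma> then (cmod (run_circuit C \<phi> y))\<^sup>2 * h \<sigma> else 0)"
    by (rule sum.swap)
  also have "\<dots> = (\<Sum>y<2 ^ width C. (cmod (run_circuit C \<phi> y))\<^sup>2 * h (outcome n y))"
    by (rule sum.cong) (simp_all add: finite_bool_lists outcome_def)
  finally show ?thesis .
qed

context description_machine
begin

text \<open>From low to high qubits, \<open>B\<close> holds the tested copy, \<open>s\<close> idle
  copies, the register of \<open>A\<close>, two constants, the program wires, an ancilla and
  \<open>m + 1\<close> wires for the zero test. With the tested copy lowest, the gates of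
  \<open>G \<sigma>\<close> act at their own indices.\<close>

lemma distinguisher:
  assumes A: "valid_circuit A" "t * m \<le> width A" "n \<le> width A"
  obtains B where
    "valid_circuit B" "Suc (s + t) * m \<le> width B" "1 \<le> width B"
    "width B = s * m + width A + card wires + 2 * m + 4"
    "length (gates B) \<le> length (gates A) + 2 * m + 15 + 20 * (K * length (gate_list m)) +
       card wires * (K * (Q * S) + K * length (gate_list m) + Q * S + 2)"
    "\<And>\<psi>. \<psi> \<in> pure_states m \<Longrightarrow> accept_prob B (copies m (Suc (s + t)) \<psi>) =
       (\<Sum>\<sigma> | length \<sigma> = n.
          output_prob A (copies m t \<psi>) \<sigma> * overlap m (gen_state G \<sigma>) \<psi>)"
proof -
  define o' where "o' = s * m"
  define Z where "Z = o' + width A"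
  define d where "d = Z + 2 + card wires"
  define base where "base = Suc d"
  define N where "N = base + m + 1"
  have "o' + n \<le> Z" using A by (simp add: Z_def)
  from description_circuit[OF this] obtain prog cs where
    prog: "\<forall>g \<in> set prog. classical g \<and> valid_gate d g"
      "length prog \<le> card wires * (K * (Q * S) + K * length (gate_list m) + Q * S + 2)" and
    cs: "\<forall>(c, g) \<in> set cs. valid_gate m g \<and> c < d" "length cs \<le> K * length (gate_list m)" and
    spec: "\<And>x w. length w = n \<Longrightarrow> (\<And>i. i < n \<Longrightarrow> bit x (o' + i) \<longleftrightarrow> w ! i) \<Longrightarrow>
       bit x Z \<Longrightarrow> bit x (Suc Z) \<Longrightarrow> (\<And>i. Z + 2 \<le> i \<Longrightarrow> \<not> bit x i) \<Longrightarrow>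
       (\<forall>i. i < Z + 2 \<or> d \<le> i \<longrightarrow> bit (fold gate_perm prog x) i = bit x i) \<and>
       map snd (filter (\<lambda>(c, g). bit (fold gate_perm prog x) c) cs) = rev (gates (G w))"
    unfolding d_def by blast
  \<comment> \<open>The gates of \<open>A\<close> are shifted past the idle copies; in
    \<open>B\<close> all of \<open>pre\<close> is shifted once more by \<open>m\<close>, past the
    tested copy.\<close>
  define pre where "pre = map (shift_gate o') (gates A) @ not_gates (Suc Z) @ not_gates Z @ prog"
  define ctl where "ctl = controlled_gates m d cs"
  define post where "post = zero_test (m + Z) (m + base) m"
  define B where "B = \<lparr>width = m + N, gates = map (shift_gate m) pre @ ctl @ post\<rparr>"
  have le: "o' + width A \<le> N" "Suc Z < N" "d < N" "Z \<le> N" "Z < N"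
    by (simp_all add: Z_def N_def base_def d_def)
  have prog_N: "\<forall>g \<in> set prog. valid_gate N g"
    using prog(1) le by (auto intro: valid_gate_mono)
  have shiftA: "\<forall>g \<in> set (map (shift_gate o') (gates A)). valid_gate N g"
    using A(1) le(1) valid_gate_mono[OF valid_shift_gate] by (auto simp: valid_circuit_iff)
  have pre_N: "\<forall>g \<in> set pre. valid_gate N g"
    using shiftA prog_N valid_not_gates[of Z N] valid_not_gates[of "Suc Z" N] le
    unfolding pre_def set_append by blast
  have ctl_N: "\<forall>g \<in> set ctl. valid_gate (m + N) g"
    unfolding ctl_def by (rule valid_controlled_gates) (use cs le in auto)
  have post_N: "\<forall>g \<in> set post. classical g \<and> valid_gate (m + N) g"
    unfolding post_def by (rule valid_zero_test) (simp_all add: N_def base_def d_def)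
  show thesis
  proof
    show "valid_circuit B"
      using pre_N ctl_N post_N by (auto simp: B_def valid_circuit_iff intro: valid_shift_gate)
    show "Suc (s + t) * m \<le> width B" "1 \<le> width B"
      using A(2) by (simp_all add: B_def N_def base_def d_def Z_def o'_def algebra_simps)
    show "width B = s * m + width A + card wires + 2 * m + 4"
      by (simp add: B_def N_def base_def d_def Z_def o'_def)
    have "length ctl \<le> 20 * (K * length (gate_list m))"
      unfolding ctl_def by (rule order_trans[OF length_controlled_gates]) (use cs(2) in simp)
    \<comment> \<open>The 15 counts two NOTs of six gates each, the initial CNOT of the zero test
      and its two final ones.\<close>
    then show "length (gates B) \<le> length (gates A) + 2 * m + 15 + 20 * (K * length (gate_list m)) +
       card wires * (K * (Q * S) + K * length (gate_list m) + Q * S + 2)"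
      using prog(2) by (simp add: B_def pre_def post_def zero_test_def length_nor_gates not_gates_def)
  next
    fix \<psi> assume \<psi>: "\<psi> \<in> pure_states m"
    define \<alpha> where "\<alpha> = run_circuit A (copies m t \<psi>)"
    define r0 where "r0 = tensor o' (copies m s \<psi>) \<alpha>"
    define r1 where "r1 = run_gates pre (tensor o' (copies m s \<psi>) (copies m t \<psi>))"
    \<comment> \<open>On basis labels, \<open>f\<close> is the classical computation: it sets the
      constants and runs the program, taking the state \<open>r0\<close> right after
      \<open>A\<close> to \<open>r1\<close>.\<close>
    define f where "f u = fold gate_perm prog (flip_bit Z (flip_bit (Suc Z) u))" for u :: nat
    define gs where "gs v = map snd (filter (\<lambda>(c, g). bit v c) cs)" for v :: nat
    define h where "h = fold gate_perm post"
    define \<Phi> where "\<Phi> = run_gates ctl (tensor m \<psi> r1)"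
    define ov where "ov y = overlap m (gen_state G (outcome n y)) \<psi>" for y :: nat
    have \<alpha>_pure: "\<alpha> \<in> pure_states (width A)"
      unfolding \<alpha>_def run_circuit_def
      by (rule pure_states_run)
        (use A pure_states_mono[OF copies_pure[OF \<psi>] A(2)] in \<open>auto simp: valid_circuit_iff\<close>)
    have r0_supp: "supported Z r0"
      unfolding r0_def Z_def using \<alpha>_pure by (auto simp: pure_states_iff intro: supported_tensor)
    have r1_eq: "r1 = run_gates prog (\<lambda>u. r0 (flip_bit (Suc Z) (flip_bit Z u)))"
      unfolding r1_def pre_def fold_append comp_apply run_shift_gate run_not_gates
      by (simp add: r0_def \<alpha>_def run_circuit_def)
    have r1_f: "r1 (f u) = r0 u" for u
      unfolding r1_eq f_def
      by (subst run_classical) (use prog(1) in \<open>auto simp: valid_gate_def\<close>)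
    have r1_supp: "supported N r1"
      unfolding r1_def
    proof (rule supported_run[OF pre_N])
      have "supported (o' + width A) (tensor o' (copies m s \<psi>) (copies m t \<psi>))"
        by (rule supported_tensor)
          (use pure_states_mono[OF copies_pure[OF \<psi>] A(2)] in \<open>simp add: pure_states_iff\<close>)
      then show "supported N (tensor o' (copies m s \<psi>) (copies m t \<psi>))"
        using le(1) by (rule supported_mono)
    qed
    have bij_f: "bij_betw f {..<2 ^ N} {..<2 ^ N}"
    proof -
      have flip: "bij_betw (flip_bit i) {..<2 ^ N} {..<(2 :: nat) ^ N}" if "i < N" for i
        by (rule bij_betw_byWitness[where f' = "flip_bit i"]) (use that in \<open>auto simp: flip_bit_less\<close>)
      have "bij_betw (fold gate_perm prog \<circ> (flip_bit Z \<circ> flip_bit (Suc Z))) {..<2 ^ N} {..<2 ^ N}"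
        by (rule bij_betw_trans[OF bij_betw_trans[OF flip flip] bij_betw_classical[OF prog_N]])
          (use le in auto)
      then show ?thesis unfolding f_def comp_def .
    qed
    have f_spec: "bit (f u) Z \<and> (\<forall>i \<ge> d. \<not> bit (f u) i) \<and>
        gs (f u) = rev (gates (G (outcome n (drop_bit o' u))))"
      if u: "u < 2 ^ Z" for u
    proof -
      let ?x = "flip_bit Z (flip_bit (Suc Z) u)"
      have x: "bit ?x i \<longleftrightarrow> (if i = Z \<or> i = Suc Z then True else bit u i)" for i
        using bit_less_power[OF u, of Z] bit_less_power[OF u, of "Suc Z"]
        by (auto simp: bit_flip_bit_iff)
      have zero: "\<not> bit ?x i" if "Z + 2 \<le> i" for i
        using bit_less_power[OF u, of i] that by (simp add: x)
      have "bit ?x (o' + i) \<longleftrightarrow> outcome n (drop_bit o' u) ! i" if "i < n" for i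
      proof -
        have "o' + i < Z" using that A(3) by (simp add: Z_def)
        then show ?thesis using that by (simp add: x outcome_def bit_drop_bit_eq)
      qed
      from spec[OF _ this _ _ zero] show ?thesis
        using x zero by (auto simp: outcome_def f_def gs_def d_def)
    qed
    \<comment> \<open>All amplitude of \<open>r1\<close> lies on images of labels with clean wires,
      for which the program is known to be correct.\<close>
    have r1_nonzero: "\<exists>u<2 ^ Z. v = f u" if "r1 v \<noteq> 0" for v
    proof -
      have "v < 2 ^ N" using that r1_supp by (auto simp: supported_def not_le)
      then obtain u where "v = f u" using bij_f by (auto simp: bij_betw_def)
      moreover from this have "u < 2 ^ Z"
        using that r0_supp by (simp add: r1_f supported_def) (meson not_le)
      ultimately show ?thesis by blast
    qed
    have \<Phi>: "\<Phi> = blocks m (\<lambda>v a. r1 v * fold adjoint_gate (gs v) \<psi> a)"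
    proof -
      have tensor: "tensor m \<psi> r1 = blocks m (\<lambda>v a. r1 v * \<psi> a)"
        by (auto simp: tensor_def blocks_def fun_eq_iff)
      have zero: "(\<lambda>a. r1 v * \<psi> a) = (\<lambda>_. 0)" if "bit v d" for v
        using r1_nonzero[of v] f_spec that by (cases "r1 v = 0") auto
      have "\<Phi> = blocks m (\<lambda>v. fold adjoint_gate (gs v) (\<lambda>a. r1 v * \<psi> a))"
        unfolding \<Phi>_def ctl_def gs_def tensor
        by (rule run_controlled_gates) (use cs(1) in auto, rule zero)
      then show ?thesis by (simp add: fold_adjoint_scale)
    qed
    have bij_h: "bij_betw h {..<2 ^ (m + N)} {..<2 ^ (m + N)}"
      unfolding h_def by (rule bij_betw_classical) (use post_N in auto)
    have run_h: "run_gates post \<Phi> (h x) = \<Phi> x" for x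
      unfolding h_def by (rule run_classical) (use post_N in \<open>auto simp: valid_gate_def\<close>)
    have "(\<Sum>x<2 ^ (m + N). of_bool (bit x 0) * (cmod (run_gates post \<Phi> x))\<^sup>2) =
        (\<Sum>x<2 ^ (m + N). of_bool (bit (h x) 0) * (cmod (\<Phi> x))\<^sup>2)"
      using sum.reindex_bij_betw[OF bij_h, of "\<lambda>x. of_bool (bit x 0) * (cmod (run_gates post \<Phi> x))\<^sup>2"]
      by (simp only: run_h)
    moreover have "accept_prob B (copies m (Suc (s + t)) \<psi>) =
        (\<Sum>x<2 ^ (m + N). of_bool (bit x 0) * (cmod (run_gates post \<Phi> x))\<^sup>2)"
    proof -
      have "run_circuit B (copies m (Suc (s + t)) \<psi>) = run_gates post \<Phi>"
        by (simp add: run_circuit_def B_def copies_Suc copies_add run_shift_gate \<Phi>_def r1_def o'_def)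
      then show ?thesis
        by (simp add: accept_prob_def outcome_prob_def B_def Int_commute)
    qed
    ultimately have "accept_prob B (copies m (Suc (s + t)) \<psi>) =
        (\<Sum>x<2 ^ (m + N). of_bool (bit (h x) 0) * (cmod (\<Phi> x))\<^sup>2)" by (simp only:)
    \<comment> \<open>Where \<open>r1\<close> vanishes both sides are 0. Elsewhere the constant is
      set and the test wires are clean, so qubit 0 reports whether the tested register is
      zero.\<close>
    also have "\<dots> = (\<Sum>x<2 ^ (m + N). of_bool (take_bit m x = 0) *
        (cmod (r1 (drop_bit m x) * fold adjoint_gate (gs (drop_bit m x)) \<psi> (take_bit m x)))\<^sup>2)"
    proof (rule sum.cong)
      fix x :: nat
      show "of_bool (bit (h x) 0) * (cmod (\<Phi> x))\<^sup>2 = of_bool (take_bit m x = 0) *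
        (cmod (r1 (drop_bit m x) * fold adjoint_gate (gs (drop_bit m x)) \<psi> (take_bit m x)))\<^sup>2"
      proof (cases "r1 (drop_bit m x) = 0")
        case True
        then show ?thesis by (simp add: \<Phi> blocks_def)
      next
        case False
        then obtain u where u: "u < 2 ^ Z" "drop_bit m x = f u" using r1_nonzero by blast
        have "bit x (m + Z)" using f_spec[OF u(1)] by (simp flip: u(2) add: bit_drop_bit_eq)
        moreover have "\<not> bit x i" if "m + base \<le> i" for i
        proof -
          have "\<not> bit (drop_bit m x) (i - m)" using f_spec[OF u(1)] that by (simp add: u(2) base_def)
          then show ?thesis using that by (simp add: bit_drop_bit_eq)
        qed
        ultimately have "bit (h x) 0 \<longleftrightarrow> take_bit m x = 0"
          unfolding h_def post_def by (intro bit_zero_test) (simp_all add: base_def d_def)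
        then show ?thesis by (simp add: \<Phi> blocks_def)
      qed
    qed simp
    also have "\<dots> = (\<Sum>a<2 ^ m. \<Sum>v<2 ^ N. of_bool (a = 0) *
        (cmod (r1 v * fold adjoint_gate (gs v) \<psi> a))\<^sup>2)"
      by (rule sum_tensor_split)
    also have "\<dots> = (\<Sum>v<2 ^ N. (cmod (r1 v * fold adjoint_gate (gs v) \<psi> 0))\<^sup>2)"
    proof -
      have "(\<Sum>a<2 ^ m. \<Sum>v<2 ^ N. of_bool (a = 0) * (cmod (r1 v * fold adjoint_gate (gs v) \<psi> a))\<^sup>2) =
        (\<Sum>a<2 ^ m. if a = 0 then \<Sum>v<2 ^ N. (cmod (r1 v * fold adjoint_gate (gs v) \<psi> a))\<^sup>2 else 0)"
        by (rule sum.cong) auto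
      then show ?thesis by simp
    qed
    \<comment> \<open>Reindexing by \<open>f\<close> removes the classical computation from the sum,
      so its garbage never has to be uncomputed.\<close>
    also have "\<dots> = (\<Sum>u<2 ^ N. (cmod (r1 (f u) * fold adjoint_gate (gs (f u)) \<psi> 0))\<^sup>2)"
      by (rule sum.reindex_bij_betw[OF bij_f, symmetric])
    also have "\<dots> = (\<Sum>u<2 ^ Z. (cmod (r0 u * fold adjoint_gate (gs (f u)) \<psi> 0))\<^sup>2)"
      unfolding r1_f
    proof (rule sum.mono_neutral_right)
      show "{..<2 ^ Z} \<subseteq> {..<(2 :: nat) ^ N}"
        using power_increasing[OF le(4), of "2 :: nat"] by auto
    qed (use r0_supp in \<open>auto simp: supported_def\<close>)
    also have "\<dots> = (\<Sum>u<2 ^ (o' + width A).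
        (cmod (copies m s \<psi> (take_bit o' u)))\<^sup>2 * ((cmod (\<alpha> (drop_bit o' u)))\<^sup>2 * ov (drop_bit o' u)))"
    proof (rule sum.cong)
      fix u assume "u \<in> {..<(2 :: nat) ^ (o' + width A)}"
      then have u: "u < 2 ^ Z" by (simp add: Z_def)
      have w: "length (outcome n (drop_bit o' u)) = n" by (simp add: outcome_def)
      have "ov (drop_bit o' u) = (cmod (fold adjoint_gate (gs (f u)) \<psi> 0))\<^sup>2"
        using f_spec[OF u] overlap_gen_state[where G = G and \<psi> = \<psi>, OF valid[OF w] width[OF w]] by (simp add: ov_def)
      then show "(cmod (r0 u * fold adjoint_gate (gs (f u)) \<psi> 0))\<^sup>2 =
        (cmod (copies m s \<psi> (take_bit o' u)))\<^sup>2 * ((cmod (\<alpha> (drop_bit o' u)))\<^sup>2 * ov (drop_bit o' u))"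
        by (simp add: r0_def tensor_def norm_mult power_mult_distrib)
    qed (simp add: Z_def)
    also have "\<dots> = (\<Sum>j<2 ^ o'. \<Sum>y<2 ^ width A. (cmod (copies m s \<psi> j))\<^sup>2 * ((cmod (\<alpha> y))\<^sup>2 * ov y))"
      by (rule sum_tensor_split)
    \<comment> \<open>The idle copies factor out with total probability 1.\<close>
    also have "\<dots> = norm2 o' (copies m s \<psi>) * (\<Sum>y<2 ^ width A. (cmod (\<alpha> y))\<^sup>2 * ov y)"
      by (simp add: norm2_def sum_product)
    also have "\<dots> = (\<Sum>y<2 ^ width A. (cmod (\<alpha> y))\<^sup>2 * ov y)"
      using copies_pure[OF \<psi>, of s] by (simp add: pure_states_iff o'_def)
    also have "\<dots> = (\<Sum>\<sigma> | length \<sigma> = n.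
          output_prob A (copies m t \<psi>) \<sigma> * overlap m (gen_state G \<sigma>) \<psi>)"
      unfolding \<alpha>_def ov_def by (rule output_prob_sum[symmetric])
    finally show "accept_prob B (copies m (Suc (s + t)) \<psi>) = (\<Sum>\<sigma> | length \<sigma> = n.
          output_prob A (copies m t \<psi>) \<sigma> * overlap m (gen_state G \<sigma>) \<psi>)" .
  qed
qed

end

section \<open>Overlap with a Haar random state\<close>

text \<open>Permutations of the basis with phases; their invariance is all that the second moments
  require.\<close>

definition monomial_matrix :: "(nat \<Rightarrow> nat) \<Rightarrow> (nat \<Rightarrow> complex) \<Rightarrow> nat \<Rightarrow> nat \<Rightarrow> complex" where
  "monomial_matrix p s x y = (if y = p x then s x else 0)"

lemma apply_monomial_matrix:
  assumes "\<And>x. x < d \<Longrightarrow> p x < d"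
  shows "apply_matrix d (monomial_matrix p s) \<psi> = (\<lambda>x. if x < d then s x * \<psi> (p x) else 0)"
proof
  fix x
  have "(\<Sum>y<d. monomial_matrix p s x y * \<psi> y) = (\<Sum>y<d. if y = p x then s x * \<psi> y else 0)"
    by (rule sum.cong) (auto simp: monomial_matrix_def)
  then show "apply_matrix d (monomial_matrix p s) \<psi> x = (if x < d then s x * \<psi> (p x) else 0)"
    using assms[of x] by (simp add: apply_matrix_def)
qed

lemma unitary_monomial_matrix:
  assumes p: "\<And>x. x < d \<Longrightarrow> p x < d" "\<And>x. x < d \<Longrightarrow> p (p x) = x" and s: "\<And>x. cmod (s x) = 1"
  shows "unitary d (monomial_matrix p s)"
  unfolding unitary_def
proof (intro allI impI)
  fix x y assume xy: "x < d" "y < d"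
  have s1: "cnj (s z) * s z = 1" for z
    using s[of z] by (simp add: complex_norm_square[symmetric] mult.commute)
  have "cnj (monomial_matrix p s z x) * monomial_matrix p s z y =
      (if z = p x then if x = y then 1 else 0 else 0)" if "z < d" for z
    using that xy p s1 by (auto simp: monomial_matrix_def)
  then have "(\<Sum>z<d. cnj (monomial_matrix p s z x) * monomial_matrix p s z y) =
      (\<Sum>z<d. if z = p x then if x = y then 1 else 0 else 0)"
    by (intro sum.cong) auto
  then show "(\<Sum>z<d. cnj (monomial_matrix p s z x) * monomial_matrix p s z y) =
      (if x = y then 1 else 0)"
    using p(1)[OF xy(1)] by simp
qed

locale haar =
  fixes m :: nat and \<mu> :: "qvec measure"
  assumes haar: "haar_states m \<mu>"
begin

sublocale prob_space \<mu>
  using haar by (simp add: haar_states_def)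

lemma sets_haar: "sets \<mu> = sets (restrict_space borel (pure_states m))"
  using haar by (simp add: haar_states_def)

lemma space_haar: "space \<mu> = pure_states m"
  using sets_eq_imp_space_eq[OF sets_haar] by (simp add: space_restrict_space)

lemma measurable_coordinate: "(\<lambda>\<psi>. \<psi> x) \<in> borel_measurable \<mu>"
proof -
  have "(\<lambda>\<psi> :: qvec. \<psi> x) \<in> borel_measurable borel"
    by (intro borel_measurable_continuous_onI continuous_on_product_coordinates)
  then have "(\<lambda>\<psi> :: qvec. \<psi> x) \<in> borel_measurable (restrict_space borel (pure_states m))"
    by (rule measurable_restrict_space1)
  then show ?thesis by (simp add: measurable_cong_sets[OF sets_haar refl])
qed

lemma norm_coordinate: "\<psi> \<in> pure_states m \<Longrightarrow> cmod (\<psi> x) \<le> 1"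
proof (cases "x < 2 ^ m")
  case True
  assume \<psi>: "\<psi> \<in> pure_states m"
  have "(cmod (\<psi> x))\<^sup>2 \<le> (\<Sum>y<2 ^ m. (cmod (\<psi> y))\<^sup>2)"
    using True by (intro member_le_sum) auto
  then show ?thesis using \<psi> by (simp add: pure_states_def abs_square_le_1)
next
  case False
  assume "\<psi> \<in> pure_states m"
  with False show ?thesis by (simp add: pure_states_def)
qed

lemma measurable_moment: "(\<lambda>\<psi>. \<psi> x * cnj (\<psi> y)) \<in> borel_measurable \<mu>"
proof -
  have "cnj \<in> borel_measurable borel"
    by (intro borel_measurable_continuous_onI continuous_intros)
  then have "(\<lambda>\<psi>. cnj (\<psi> y)) \<in> borel_measurable \<mu>"
    by (rule measurable_compose[OF measurable_coordinate])
  then show ?thesis by (intro borel_measurable_times measurable_coordinate)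
qed

lemma integrable_moment: "integrable \<mu> (\<lambda>\<psi>. \<psi> x * cnj (\<psi> y))"
proof (rule integrable_const_bound[where B = 1])
  show "AE \<psi> in \<mu>. norm (\<psi> x * cnj (\<psi> y)) \<le> 1"
    using norm_coordinate
    by (intro AE_I2) (auto simp: space_haar norm_mult intro: mult_le_one)
qed (rule measurable_moment)

text \<open>A change of variables under the invariance of \<open>\<mu>\<close>. The work lies in
  showing that the substitution maps the sphere measurably to itself; measurability is checked
  coordinatewise.\<close>

lemma integral_monomial:
  fixes g :: "qvec \<Rightarrow> complex"
  assumes p: "\<And>x. x < 2 ^ m \<Longrightarrow> p x < 2 ^ m" "\<And>x. x < 2 ^ m \<Longrightarrow> p (p x) = x"
    and s: "\<And>x. cmod (s x) = 1" and g: "g \<in> borel_measurable \<mu>"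
  shows "(LINT \<psi>|\<mu>. g (\<lambda>x. if x < 2 ^ m then s x * \<psi> (p x) else 0)) = (LINT \<psi>|\<mu>. g \<psi>)"
proof -
  let ?f = "\<lambda>\<psi> x. if x < 2 ^ m then s x * \<psi> (p x) else 0"
  have eq: "apply_matrix (2 ^ m) (monomial_matrix p s) = ?f"
    by (rule ext) (rule apply_monomial_matrix[OF p(1)])
  have meas_f: "?f \<in> borel_measurable \<mu>"
  proof (rule measurable_coordinatewise_then_product)
    fix x
    show "(\<lambda>\<psi>. ?f \<psi> x) \<in> borel_measurable \<mu>"
      by (cases "x < 2 ^ m") (simp_all add: borel_measurable_times measurable_coordinate)
  qed
  have pure: "?f \<psi> \<in> pure_states m" if "\<psi> \<in> pure_states m" for \<psi>
  proof -
    have "(\<Sum>x<2 ^ m. (cmod (?f \<psi> x))\<^sup>2) = (\<Sum>x<2 ^ m. (cmod (\<psi> (p x)))\<^sup>2)"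
      by (rule sum.cong) (simp_all add: norm_mult s)
    also have "\<dots> = (\<Sum>x<2 ^ m. (cmod (\<psi> x))\<^sup>2)"
      by (rule sum_involution) (use p in auto)
    finally show ?thesis using that by (simp add: pure_states_def)
  qed
  have "?f \<in> \<mu> \<rightarrow>\<^sub>M restrict_space borel (pure_states m)"
    by (rule measurable_restrict_space2[OF Pi_I meas_f]) (rule pure, simp only: space_haar)
  then have meas: "?f \<in> \<mu> \<rightarrow>\<^sub>M \<mu>"
    by (simp only: measurable_cong_sets[OF refl sets_haar])
  have "unitary (2 ^ m) (monomial_matrix p s)"
    by (rule unitary_monomial_matrix) (simp_all add: p s)
  then have "distr \<mu> \<mu> (apply_matrix (2 ^ m) (monomial_matrix p s)) = \<mu>"
    using haar by (simp only: haar_states_def)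
  then have "distr \<mu> \<mu> ?f = \<mu>" by (simp only: eq)
  then show ?thesis using integral_distr[OF meas g] by simp
qed

text \<open>Flipping the sign of coordinate \<open>x\<close> negates an off-diagonal moment, which
  is thus 0. Transpositions make the diagonal moments equal, and these add up to the squared norm
  1.\<close>

lemma moment:
  assumes "x < 2 ^ m" "y < 2 ^ m"
  shows "(LINT \<psi>|\<mu>. \<psi> x * cnj (\<psi> y)) = (if x = y then 1 / 2 ^ m else 0)"
proof (cases "x = y")
  case False
  let ?s = "\<lambda>z. if z = x then - 1 else 1 :: complex"
  have "(LINT \<psi>|\<mu>. \<psi> x * cnj (\<psi> y)) = - (LINT \<psi>|\<mu>. \<psi> x * cnj (\<psi> y))"
    using integral_monomial[of "\<lambda>z. z" ?s "\<lambda>\<psi>. \<psi> x * cnj (\<psi> y)"] assms False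
    by (simp add: measurable_moment)
  then have "(LINT \<psi>|\<mu>. \<psi> x * cnj (\<psi> y)) = 0"
    by (simp only: complex_eq_iff) simp
  with False show ?thesis by simp
next
  case True
  have eq: "(LINT \<psi>|\<mu>. \<psi> z * cnj (\<psi> z)) = (LINT \<psi>|\<mu>. \<psi> x * cnj (\<psi> x))" if "z < 2 ^ m" for z
    using integral_monomial[of "Transposition.transpose x z" "\<lambda>_. 1" "\<lambda>\<psi>. \<psi> x * cnj (\<psi> x)"]
      that assms by (simp add: Transposition.transpose_def measurable_moment)
  have "of_nat (2 ^ m) * (LINT \<psi>|\<mu>. \<psi> x * cnj (\<psi> x)) =
      (\<Sum>z<2 ^ m. (LINT \<psi>|\<mu>. \<psi> z * cnj (\<psi> z)))"
    by (simp add: eq)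
  also have "\<dots> = (LINT \<psi>|\<mu>. (\<Sum>z<2 ^ m. \<psi> z * cnj (\<psi> z)))"
    by (rule Bochner_Integration.integral_sum[symmetric]) (rule integrable_moment)
  also have "\<dots> = (LINT \<psi>|\<mu>. 1)"
  proof (rule Bochner_Integration.integral_cong)
    fix \<psi> assume "\<psi> \<in> space \<mu>"
    then have "norm2 m \<psi> = 1" by (simp add: space_haar pure_states_iff)
    then show "(\<Sum>z<2 ^ m. \<psi> z * cnj (\<psi> z)) = 1"
      using inner_self[of m \<psi>] by (simp add: inner_w_def mult.commute)
  qed simp
  finally show ?thesis using True by (simp add: prob_space field_simps)
qed

lemma overlap_expand:
  "complex_of_real (overlap m \<phi> \<psi>) =
    (\<Sum>x<2 ^ m. \<Sum>y<2 ^ m. cnj (\<phi> x) * \<phi> y * (\<psi> x * cnj (\<psi> y)))"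
  unfolding overlap_def
  by (simp add: complex_norm_square sum_product algebra_simps del: of_real_power)
    (rule sum.swap)

text \<open>The moments say that the projector on a Haar random state averages to the identity
  divided by \<open>2 ^ m\<close>, and the overlap is linear in that projector.\<close>

lemma
  assumes "\<phi> \<in> pure_states m"
  shows integrable_overlap: "integrable \<mu> (overlap m \<phi>)"
    and integral_overlap: "(LINT \<psi>|\<mu>. overlap m \<phi> \<psi>) = 1 / 2 ^ m"
proof -
  have int: "integrable \<mu> (\<lambda>\<psi>. cnj (\<phi> x) * \<phi> y * (\<psi> x * cnj (\<psi> y)))" for x y
    by (intro integrable_mult_right integrable_moment)
  then have "integrable \<mu> (\<lambda>\<psi>. complex_of_real (overlap m \<phi> \<psi>))"
    unfolding overlap_expand by (intro Bochner_Integration.integrable_sum)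
  then have "integrable \<mu> (\<lambda>\<psi>. Re (complex_of_real (overlap m \<phi> \<psi>)))"
    by (rule integrable_Re)
  then show "integrable \<mu> (overlap m \<phi>)" by simp
  have "complex_of_real (LINT \<psi>|\<mu>. overlap m \<phi> \<psi>) =
      (LINT \<psi>|\<mu>. complex_of_real (overlap m \<phi> \<psi>))"
    by simp
  also have "\<dots> = (\<Sum>x<2 ^ m. \<Sum>y<2 ^ m. cnj (\<phi> x) * \<phi> y * (LINT \<psi>|\<mu>. \<psi> x * cnj (\<psi> y)))"
    unfolding overlap_expand
    by (subst Bochner_Integration.integral_sum, intro Bochner_Integration.integrable_sum int)
      (subst Bochner_Integration.integral_sum, rule int, simp)
  also have "\<dots> = (\<Sum>x<2 ^ m. \<Sum>y<2 ^ m. if y = x then cnj (\<phi> x) * \<phi> x / 2 ^ m else 0)"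
    by (intro sum.cong refl) (simp add: moment)
  also have "\<dots> = inner_w m \<phi> \<phi> / 2 ^ m"
    by (simp add: inner_w_def sum_divide_distrib)
  also have "\<dots> = complex_of_real (1 / 2 ^ m)"
    using assms by (simp add: inner_self pure_states_iff)
  finally show "(LINT \<psi>|\<mu>. overlap m \<phi> \<psi>) = 1 / 2 ^ m"
    by (simp only: of_real_eq_iff)
qed

end

section \<open>Polynomial bounds and negligible functions\<close>

definition poly_bounded :: "(nat \<Rightarrow> nat) \<Rightarrow> bool" where
  "poly_bounded f \<longleftrightarrow> (\<exists>p :: nat poly. \<forall>n. f n \<le> poly p n)"

lemma poly_bounded_poly: "poly_bounded (poly p)"
  by (auto simp: poly_bounded_def)

lemma poly_bounded_const: "poly_bounded (\<lambda>_. c)"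
  unfolding poly_bounded_def by (rule exI[of _ "[:c:]"]) simp

lemma poly_bounded_id: "poly_bounded (\<lambda>n. n)"
  unfolding poly_bounded_def by (rule exI[of _ "[:0, 1:]"]) simp

lemma poly_bounded_add: "poly_bounded f \<Longrightarrow> poly_bounded g \<Longrightarrow> poly_bounded (\<lambda>n. f n + g n)"
  unfolding poly_bounded_def by (metis add_mono poly_add)

lemma poly_bounded_mult: "poly_bounded f \<Longrightarrow> poly_bounded g \<Longrightarrow> poly_bounded (\<lambda>n. f n * g n)"
  unfolding poly_bounded_def by (metis mult_le_mono poly_mult)

lemma poly_bounded_mono: "poly_bounded g \<Longrightarrow> (\<And>n. f n \<le> g n) \<Longrightarrow> poly_bounded f"
  unfolding poly_bounded_def by (meson le_trans)

lemmas poly_bounded_intros =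
  poly_bounded_poly poly_bounded_const poly_bounded_id poly_bounded_add poly_bounded_mult

section \<open>Circuit sizes from running times\<close>

lemma circuit_size_le_encoding: "circuit_size C \<le> length (encode_circuit C)"
proof -
  have "length gs \<le> length (concat (map encode_gate gs))" for gs
  proof (induction gs)
    case (Cons g gs)
    have "1 \<le> length (encode_gate g)" using encode_gate_nonempty[of g] by linarith
    with Cons show ?case
      unfolding list.map concat.simps length_append list.size by linarith
  qed simp
  then show ?thesis by (simp add: circuit_size_def encode_circuit_def encode_nat_def)
      (meson le_SucI)
qed

lemma polytime_output_length:
  assumes "polytime_computable f"
  obtains p where "\<And>w. length (f w) \<le> poly p (length w)"
proof -
  obtain M and p :: "nat poly" where
    "\<And>w. tm_halted_with ((tm_step M ^^ poly p (length w)) (tm_init w)) (f w)"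
    using assms by (auto simp: polytime_computable_def)
  then have "length (f w) \<le> poly ([:0, 1:] + p) (length w)" for w
    using tm_output_length by fastforce
  then show thesis by (rule that)
qed

lemma uniform_QPT_size:
  assumes "uniform_QPT A"
  shows "poly_bounded (\<lambda>n. circuit_size (A n))"
proof -
  obtain f where f: "polytime_computable f" "\<And>n. f (replicate n True) = encode_circuit (A n)"
    using assms by (auto simp: uniform_QPT_def)
  obtain p where p: "\<And>w. length (f w) \<le> poly p (length w)"
    using polytime_output_length[OF f(1)] by blast
  have "circuit_size (A n) \<le> poly p n" for n
    using circuit_size_le_encoding[of "A n"] p[of "replicate n True"] by (simp add: f(2))
  then show ?thesis by (rule poly_bounded_mono[OF poly_bounded_poly])
qed

lemma negligible_add:
  assumes "negligible f" "negligible g"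
  shows "negligible (\<lambda>n. f n + g n)"
  unfolding negligible_def
proof (intro allI impI)
  fix c :: real assume c: "c > 0"
  \<comment> \<open>The extra power of \<open>n\<close> absorbs the factor 2 from adding two
    bounds.\<close>
  have "c + 1 > 0" using c by simp
  then have "\<forall>\<^sub>F n in sequentially. f n < real n powr - (c + 1)"
    "\<forall>\<^sub>F n in sequentially. g n < real n powr - (c + 1)"
    using assms unfolding negligible_def by blast+
  moreover have "\<forall>\<^sub>F n in sequentially. 2 * real n powr - (c + 1) < real n powr - c"
    by real_asymp
  ultimately show "\<forall>\<^sub>F n in sequentially. f n + g n < real n powr - c"
    by eventually_elim linarith
qed

lemma negligible_powr:
  assumes "a > 0"
  shows "negligible (\<lambda>n. 2 powr (- a * real n))"
  unfolding negligible_def using assms by (intro allI impI) real_asymp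

section \<open>One-wayness\<close>

lemma output_prob_le_1:
  assumes "valid_circuit C" "\<phi> \<in> pure_states (width C)"
  shows "output_prob C \<phi> \<sigma> \<le> 1"
proof -
  have "output_prob C \<phi> \<sigma> \<le> norm2 (width C) (run_circuit C \<phi>)"
    unfolding output_prob_def outcome_prob_def norm2_def by (rule sum_mono2) auto
  also have "\<dots> = 1"
    using pure_states_run[OF _ assms(2)] assms(1)
    by (simp add: pure_states_iff valid_circuit_iff run_circuit_def)
  finally show ?thesis .
qed

lemma overlap_nonneg: "0 \<le> overlap w \<phi> \<psi>"
  by (simp add: overlap_def)

lemma (in haar) integral_overlaps:
  assumes S: "finite S" "\<And>\<sigma>. \<sigma> \<in> S \<Longrightarrow> \<phi> \<sigma> \<in> pure_states m"
    and F: "\<And>\<psi>. \<psi> \<in> pure_states m \<Longrightarrow> F \<psi> \<le> (\<Sum>\<sigma>\<in>S. overlap m (\<phi> \<sigma>) \<psi>)"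
  shows "(LINT \<psi>|\<mu>. F \<psi>) \<le> card S / 2 ^ m"
proof -
  have int: "integrable \<mu> (\<lambda>\<psi>. \<Sum>\<sigma>\<in>S. overlap m (\<phi> \<sigma>) \<psi>)"
    using S integrable_overlap by (intro Bochner_Integration.integrable_sum) auto
  \<comment> \<open>Should \<open>F\<close> fail to be integrable, its integral is 0 by convention,
    and the nonnegative majorant still bounds it.\<close>
  have "(LINT \<psi>|\<mu>. F \<psi>) \<le> (LINT \<psi>|\<mu>. (\<Sum>\<sigma>\<in>S. overlap m (\<phi> \<sigma>) \<psi>))"
    by (rule integral_mono'[OF int]) (simp_all add: F space_haar sum_nonneg overlap_nonneg)
  also have "\<dots> = (\<Sum>\<sigma>\<in>S. (LINT \<psi>|\<mu>. overlap m (\<phi> \<sigma>) \<psi>))"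
    using S integrable_overlap by (intro Bochner_Integration.integral_sum) auto
  also have "\<dots> = card S / 2 ^ m" using S by (simp add: integral_overlap)
  finally show ?thesis .
qed

theorem lemma4p1:
  fixes m :: "nat \<Rightarrow> nat" and c :: real
  assumes "c > 1"
    and "\<forall>n. real (m n) \<ge> c * real n"
    and "\<exists>G. PRSG m G"
  shows "\<exists>m' G'. OWSG m' G'"
proof -
  obtain G \<mu> where G: "state_generator m G" and \<mu>: "\<And>n. haar_states (m n) (\<mu> n)"
    and pseudorandom: "\<And>(t :: nat poly) A. nonuniform_QPT A \<Longrightarrow>
      (\<And>n. poly t n * m n \<le> width (A n) \<and> 1 \<le> width (A n)) \<Longrightarrow>
      \<exists>negl. negligible negl \<and>
        (\<forall>n. \<bar>measure_pmf.expectation (uniform_keys n)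
                 (\<lambda>k. accept_prob (A n) (copies (m n) (poly t n) (gen_state G k)))
              - (LINT \<psi>|\<mu> n. accept_prob (A n) (copies (m n) (poly t n) \<psi>))\<bar> \<le> negl n)"
    using assms(3) unfolding PRSG_def by blast
  have valid: "valid_circuit (G k)" "width (G k) = m (length k)" for k
    using G by (auto simp: state_generator_def)
  obtain M and q :: "nat poly" where M: "wf_tm M"
    "\<And>w. tm_halted_with ((tm_step M ^^ poly q (length w)) (tm_init w)) (encode_circuit (G w))"
    using G by (auto simp: state_generator_def polytime_computable_def)
  have dm: "description_machine M G n (poly q n) (m n)" for n
    using M valid by unfold_locales auto
  \<comment> \<open>Polynomial growth of \<open>m\<close> comes from the running time of the
    generator, which writes the width in unary.\<close>
  have "m n \<le> n + poly q n" for n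
  proof -
    have "m n \<le> circuit_size (G (replicate n True))"
      using valid(2)[of "replicate n True"] by (simp add: circuit_size_def)
    also have "\<dots> \<le> n + poly q n"
      using circuit_size_le_encoding tm_output_length[OF M(2)[of "replicate n True"]] le_trans
      by fastforce
    finally show ?thesis .
  qed
  then have m_bounded: "poly_bounded m"
    by (rule poly_bounded_mono[rotated]) (intro poly_bounded_intros)
  have pure: "gen_state G k \<in> pure_states (m (length k))" for k
    using gen_state_pure[of G k] valid by simp
  have "OWSG m G"
    unfolding OWSG_def
  proof (intro conjI allI impI G)
    fix t A
    assume *: "(\<exists>p :: nat poly. \<forall>n. t n \<le> poly p n) \<and> uniform_QPT A \<and>
      (\<forall>n. t n * m n \<le> width (A n) \<and> n \<le> width (A n))"
    then obtain p :: "nat poly" where p: "\<And>n. t n \<le> poly p n" by blast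
    have A: "valid_circuit (A n)" "t n * m n \<le> width (A n)" "n \<le> width (A n)" for n
      using * by (auto simp: uniform_QPT_def)
    \<comment> \<open>\<open>p\<close> bounds \<open>t\<close>, the \<open>poly p n - t n\<close>
      surplus copies stay idle, and the added 1 is the tested copy.\<close>
    let ?r = "p + 1"
    have r: "Suc (poly p n - t n + t n) = poly ?r n" for n using p[of n] by simp
    let ?K = "\<lambda>n. n + poly q n + 1" and ?L = "\<lambda>n. length (gate_list (m n))"
      and ?Q = "num_states M" and ?S = "num_syms M"
    let ?W = "\<lambda>n. card (description_machine.wires M n (poly q n) (m n))"
    have K: "description_machine.K n (poly q n) = ?K n" for n
      by (simp add: description_machine.K_def[OF dm])
    define P where "P n B \<longleftrightarrow> valid_circuit B \<and> poly ?r n * m n \<le> width B \<and> 1 \<le> width B \<and>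
        width B = (poly p n - t n) * m n + width (A n) + ?W n + 2 * m n + 4 \<and>
        length (gates B) \<le> length (gates (A n)) + 2 * m n + 15 + 20 * (?K n * ?L n) +
          ?W n * (?K n * (?Q * ?S) + ?K n * ?L n + ?Q * ?S + 2) \<and>
        (\<forall>\<psi> \<in> pure_states (m n). accept_prob B (copies (m n) (poly ?r n) \<psi>) =
          (\<Sum>\<sigma> | length \<sigma> = n. output_prob (A n) (copies (m n) (t n) \<psi>) \<sigma> *
            overlap (m n) (gen_state G \<sigma>) \<psi>))" for n B
    have "\<exists>B. P n B" for n
      unfolding P_def r[symmetric]
      by (rule description_machine.distinguisher
          [OF dm[of n] A(1)[of n] A(2)[of n] A(3)[of n], where s = "poly p n - t n", unfolded K])
        (intro exI conjI ballI)
    \<comment> \<open>One circuit is chosen for each \<open>n\<close>, which is enough for a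
      nonuniform adversary.\<close>
    then have "\<exists>B. \<forall>n. P n (B n)" by (intro choice allI)
    then obtain B where P: "\<forall>n. P n (B n)" ..
    have B: "valid_circuit (B n)" "poly ?r n * m n \<le> width (B n)" "1 \<le> width (B n)"
      "width (B n) = (poly p n - t n) * m n + width (A n) + ?W n + 2 * m n + 4"
      "length (gates (B n)) \<le> length (gates (A n)) + 2 * m n + 15 + 20 * (?K n * ?L n) +
        ?W n * (?K n * (?Q * ?S) + ?K n * ?L n + ?Q * ?S + 2)" for n
      using P[rule_format, of n] unfolding P_def by blast+
    have accept: "accept_prob (B n) (copies (m n) (poly ?r n) \<psi>) =
        (\<Sum>\<sigma> | length \<sigma> = n. output_prob (A n) (copies (m n) (t n) \<psi>) \<sigma> *
          overlap (m n) (gen_state G \<sigma>) \<psi>)" if "\<psi> \<in> pure_states (m n)" for n \<psi>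
      using P[rule_format, unfolded P_def, of n] that by blast
    have L: "poly_bounded ?L"
      by (rule poly_bounded_mono[OF _ length_gate_list]) (intro poly_bounded_intros m_bounded)
    have W: "poly_bounded ?W"
      by (rule poly_bounded_mono[OF _ description_machine.card_wires[OF dm]])
        (simp only: K Suc_eq_plus1, intro poly_bounded_intros L)
    have sizeA: "poly_bounded (\<lambda>n. circuit_size (A n))"
      using * by (simp add: uniform_QPT_size)
    have "circuit_size (B n) \<le> poly p n * m n + circuit_size (A n) + ?W n + 2 * m n + 4 +
        (2 * m n + 15 + 20 * (?K n * ?L n) +
          ?W n * (?K n * (?Q * ?S) + ?K n * ?L n + ?Q * ?S + 2))" for n
    proof -
      have "(poly p n - t n) * m n \<le> poly p n * m n" by simp
      then show ?thesis using B(4)[of n] B(5)[of n] unfolding circuit_size_def by linarith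
    qed
    then have "poly_bounded (\<lambda>n. circuit_size (B n))"
      by (rule poly_bounded_mono[rotated]) (intro poly_bounded_intros m_bounded L W sizeA)
    then have "nonuniform_QPT B" using B(1) by (simp add: nonuniform_QPT_def poly_bounded_def)
    from pseudorandom[OF this conjI[OF B(2) B(3)]] obtain negl where negl: "negligible negl"
      "\<And>n. \<bar>measure_pmf.expectation (uniform_keys n)
                 (\<lambda>k. accept_prob (B n) (copies (m n) (poly ?r n) (gen_state G k)))
              - (LINT \<psi>|\<mu> n. accept_prob (B n) (copies (m n) (poly ?r n) \<psi>))\<bar> \<le> negl n"
      by blast
    \<comment> \<open>The identity \<open>accept\<close> needs a pure state on \<open>m n\<close>
      qubits; this holds for keys of length \<open>n\<close>, which carry the whole
      distribution.\<close>
    have game: "owsg_game m G (t n) (A n) n = measure_pmf.expectation (uniform_keys n)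
        (\<lambda>k. accept_prob (B n) (copies (m n) (poly ?r n) (gen_state G k)))" for n
      unfolding owsg_game_def
    proof (rule integral_cong_AE)
      have "set_pmf (uniform_keys n) = {k. length k = n}"
        unfolding uniform_keys_def
        by (rule set_pmf_of_set) (auto simp: finite_bool_lists intro: exI[of _ "replicate n True"])
      then show "AE k in measure_pmf (uniform_keys n).
          (\<Sum>\<sigma> | length \<sigma> = n. output_prob (A n) (copies (m n) (t n) (gen_state G k)) \<sigma> *
            overlap (m n) (gen_state G \<sigma>) (gen_state G k)) =
          accept_prob (B n) (copies (m n) (poly ?r n) (gen_state G k))"
        using accept pure by (auto simp: AE_measure_pmf_iff)
    qed simp_all
    have random: "(LINT \<psi>|\<mu> n. accept_prob (B n) (copies (m n) (poly ?r n) \<psi>)) \<le>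
        2 powr (- (c - 1) * real n)" for n
    proof -
      interpret haar "m n" "\<mu> n" by unfold_locales (rule \<mu>)
      have "(LINT \<psi>|\<mu> n. accept_prob (B n) (copies (m n) (poly ?r n) \<psi>)) \<le>
          card {\<sigma> :: bool list. length \<sigma> = n} / 2 ^ m n"
      proof (rule integral_overlaps[where \<phi> = "gen_state G"])
        fix \<psi> assume \<psi>: "\<psi> \<in> pure_states (m n)"
        have "copies (m n) (t n) \<psi> \<in> pure_states (width (A n))"
          using pure_states_mono[OF copies_pure[OF \<psi>] A(2)] .
        \<comment> \<open>Each output probability is at most 1, so the bound keeps only the
          overlaps, whose Haar averages are known.\<close>
        then show "accept_prob (B n) (copies (m n) (poly ?r n) \<psi>) \<le>
            (\<Sum>\<sigma> | length \<sigma> = n. overlap (m n) (gen_state G \<sigma>) \<psi>)"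
          unfolding accept[OF \<psi>]
          by (intro sum_mono mult_left_le_one_le output_prob_le_1 A(1))
            (simp_all add: overlap_def output_prob_def outcome_prob_def sum_nonneg)
      qed (use pure in \<open>auto simp: finite_bool_lists\<close>)
      also have "\<dots> = 2 powr (real n - real (m n))"
        using card_lists_length_eq[of "UNIV :: bool set" n]
        by (simp add: powr_diff powr_realpow)
      also have "\<dots> \<le> 2 powr (- (c - 1) * real n)"
        using assms(2) by (intro powr_mono) (simp_all add: algebra_simps)
      finally show ?thesis .
    qed
    show "\<exists>negl. negligible negl \<and> (\<forall>n. owsg_game m G (t n) (A n) n \<le> negl n)"
    proof (intro exI[of _ "\<lambda>n. negl n + 2 powr (- (c - 1) * real n)"] conjI allI)
      show "negligible (\<lambda>n. negl n + 2 powr (- (c - 1) * real n))"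
        using assms(1) by (intro negligible_add negl(1) negligible_powr) simp
      show "owsg_game m G (t n) (A n) n \<le> negl n + 2 powr (- (c - 1) * real n)" for n
        using negl(2)[of n] random[of n] unfolding game by linarith
    qed
  qed
  then show ?thesis by blast
qed

end
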